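(* Let $k\ge 2$ be a fixed integer. There exists a constant $K$ (depending only on $k$) such that if $m=m(n)$ is an integer with $Kn\log n\le m\le n^k$, then $$\lim_{n\to\infty}\Pr\left[HP^{(n)}_{n,m,k}\text{ contains a rainbow perfect matching}\right]=1.$$
   Context: Let $U_1,\dots,U_k$ be $k$ disjoint sets of size $n$ and $V=U_1\cup\cdots\cup U_k$. A $k$-partite, $k$-uniform hypergraph on $V$ (with this partition) is one whose edges each contain exactly one vertex from each $U_i$; there are $n^k$ possible edges. For a positive integer $\kappa$, the random edge-colored hypergraph $HP^{(\kappa)}_{n,m,k}$ is sampled uniformly from all $k$-partite, $k$-uniform hypergraphs on $V$ with exactly $m$ edges, each edge being assigned one of $\kappa$ colors; equivalently, the $m$-element edge set is chosen uniformly at random and then each edge independently receives a uniformly random color from $\kappa$ colors. In $HP^{(n)}_{n,m,k}$ there are $\kappa=n$ colors. A perfect matching is a set of pairwise disjoint edges whose union is $V$ (so it has $n$ edges). A set of edges is rainbow if its edges have pairwise different colors. Here $\log$ is the natural logarithm. *)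

theory Defs
  imports "HOL-Probability.Probability"
begin

text \<open>The vertex \<open>(i, a)\<close> is the \<open>a\<close>-th vertex of the \<open>i\<close>-th part; parts are indexed from 0.\<close>

type_synonym vertex = "nat \<times> nat"

definition part :: "nat \<Rightarrow> nat \<Rightarrow> vertex set" where
  "part n i = {i} \<times> {..<n}"

definition vertices :: "nat \<Rightarrow> nat \<Rightarrow> vertex set" where
  "vertices k n = (\<Union>i<k. part n i)"

definition possible_edges :: "nat \<Rightarrow> nat \<Rightarrow> vertex set set" where
  "possible_edges k n = {e. e \<subseteq> vertices k n \<and> (\<forall>i<k. card (e \<inter> part n i) = 1)}"

text \<open>A coloured hypergraph is a pair of an edge set \<open>E\<close> and a colouring of \<open>E\<close>. Colourings are
  extensional functions, so that each colouring of \<open>E\<close> is counted exactly once.\<close>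

type_synonym colored_hypergraph = "vertex set set \<times> (vertex set \<Rightarrow> nat)"

definition colored_hypergraphs :: "nat \<Rightarrow> nat \<Rightarrow> nat \<Rightarrow> nat \<Rightarrow> colored_hypergraph set" where
  "colored_hypergraphs \<kappa> n m k =
     (SIGMA E:{E. E \<subseteq> possible_edges k n \<and> card E = m}. E \<rightarrow>\<^sub>E {..<\<kappa>})"

text \<open>The uniform distribution is only meaningful if the set of coloured hypergraphs is nonempty,
  i.e. if \<open>m \<le> n ^ k\<close> and (\<open>\<kappa> \<ge> 1\<close> or \<open>m = 0\<close>).\<close>

definition HP :: "nat \<Rightarrow> nat \<Rightarrow> nat \<Rightarrow> nat \<Rightarrow> colored_hypergraph pmf" where
  "HP \<kappa> n m k = pmf_of_set (colored_hypergraphs \<kappa> n m k)"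

definition perfect_matching :: "nat \<Rightarrow> nat \<Rightarrow> vertex set set \<Rightarrow> bool" where
  "perfect_matching k n M \<longleftrightarrow>
     M \<subseteq> possible_edges k n \<and> pairwise disjnt M \<and> \<Union>M = vertices k n"

definition rainbow :: "(vertex set \<Rightarrow> nat) \<Rightarrow> vertex set set \<Rightarrow> bool" where
  "rainbow c M \<longleftrightarrow> inj_on c M"

definition has_rainbow_perfect_matching :: "nat \<Rightarrow> nat \<Rightarrow> colored_hypergraph \<Rightarrow> bool" where
  "has_rainbow_perfect_matching k n = (\<lambda>(E, c).
     \<exists>M\<subseteq>E. perfect_matching k n M \<and> rainbow c M)"

end

theory Submission
  imports Defs "HOL-Real_Asymp.Real_Asymp"
begin

text \<open>
  A rainbow perfect matching with \<open>n\<close> colours is a perfect matching of a \<open>(k + 1)\<close>-partite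
  structure whose last part is the set of colours: it is a set of \<open>n\<close> pairs (edge, colour), and it
  is coded by \<open>k\<close> permutations of \<open>{..<n}\<close>, the \<open>i\<close>-th of which sends a colour to the vertex of
  part \<open>i\<close> in the edge of that colour. Among the \<open>(n!)\<^sup>k\<close> codes, those whose matching contains
  \<open>t\<close> given pairs number at most \<open>((n - t)!)\<^sup>k \<le> (n!)\<^sup>k q\<^sup>t\<close> with \<open>q = (e / n)\<^sup>k\<close>: the uniform
  distribution on matchings is \<open>q\<close>-spread. The threshold theorem for spread families says that a
  random set of pairs containing each pair with probability about \<open>q log n\<close> contains a member of the
  family with high probability. Here this means that about \<open>n\<^sup>k \<cdot> n \<cdot> q log n = e\<^sup>k n log n\<close> edges
  suffice.

  The threshold theorem is proved by iterated minimum fragments (Frankston, Kahn, Narayanan and Park;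
  Park and Pham). Expose a random set \<open>W\<close>. For a member \<open>S\<close> of the family, let its fragment \<open>T\<close> be
  the smallest set \<open>S' - W\<close> over the members \<open>S' \<subseteq> W \<union> S\<close>. The point is that \<open>T\<close> can be
  recovered cheaply from \<open>Z = W \<union> T\<close>: by minimality, \<open>T\<close> is contained in \<^emph>\<open>every\<close> member contained
  in \<open>Z\<close>, so given \<open>Z\<close> there are at most \<open>l choose t\<close> candidates of size \<open>t\<close>, where \<open>l\<close> bounds
  the sizes of the members (\<open>fragment_core\<close>, \<open>card_core\<close>). Together with spreadness this makes the
  expected proportion of members with a fragment of size \<open>t\<close> at most \<open>(l choose t) (q / x)\<^sup>t\<close>, if each
  pair is exposed with probability \<open>x\<close> (\<open>fragment_count\<close>). With \<open>x = 64 q\<close> almost all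
  fragments have at most half the size, and fragments inherit spreadness, so about \<open>log n\<close> such
  rounds bring the size down to \<open>sqrt (log n)\<close>; one last round with \<open>x = q log n\<close> leaves nothing of
  most members (\<open>spread_threshold\<close>).

  An edge carries only one colour, so the exposed set \<open>W\<close> is the graph of a random partial function
  rather than a set of independent pairs. This changes two steps. In the counting step, \<open>Z\<close> is \<open>W\<close>
  with the pairs of \<open>T\<close> written over it; the weight of the overwritten values sums to one, so the
  bound persists (\<open>avg_plant\<close>). In the iteration, the union of two rounds may give an edge two
  colours; but for hitting a given set of colours on one edge, being shown two independent random
  colours is no better than being shown one with the sum of the two densities, since a union bound
  is attained by disjoint events. Exchanging edges one at a time gives \<open>two_round_le_one_round\<close>.

  Finally, the edges of the hypergraph are \<open>m\<close> in number rather than independent. Containing a rainbow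
  perfect matching becomes more likely as edges are added (\<open>level_mono\<close>), and a binomial number of
  edges of mean at most \<open>m / 2\<close> exceeds \<open>m\<close> with exponentially small probability
  (\<open>avg_le_level\<close>).
\<close>

section \<open>Random partial colourings\<close>

text \<open>
  Each element of \<open>E\<close> independently receives each colour of \<open>C\<close> with probability \<open>x\<close> and otherwise
  stays uncoloured; \<open>avg x E C g\<close> is the expectation of \<open>g\<close>. As everything is finite, a finite sum
  with explicit weights replaces a product measure. The weight depends only on the number of coloured
  elements, which is what the passage to a fixed number of edges uses.
\<close>

definition partial_colorings :: "'e set \<Rightarrow> 'c set \<Rightarrow> ('e \<rightharpoonup> 'c) set" where
  "partial_colorings E C = {f. dom f \<subseteq> E \<and> ran f \<subseteq> C}"

definition mass :: "real \<Rightarrow> 'e set \<Rightarrow> 'c set \<Rightarrow> ('e \<rightharpoonup> 'c) \<Rightarrow> real" where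
  "mass x E C f = x ^ card (dom f) * (1 - real (card C) * x) ^ card (E - dom f)"

definition avg :: "real \<Rightarrow> 'e set \<Rightarrow> 'c set \<Rightarrow> (('e \<rightharpoonup> 'c) \<Rightarrow> real) \<Rightarrow> real" where
  "avg x E C g = (\<Sum>f\<in>partial_colorings E C. mass x E C f * g f)"

definition color_avg :: "real \<Rightarrow> 'c set \<Rightarrow> ('c option \<Rightarrow> real) \<Rightarrow> real" where
  "color_avg x C h = (1 - real (card C) * x) * h None + x * (\<Sum>c\<in>C. h (Some c))"

lemma finite_partial_colorings:
  assumes "finite E" "finite C"
  shows "finite (partial_colorings E C)"
proof -
  have "partial_colorings E C = (\<Union>A\<in>Pow E. {f. dom f = A \<and> ran f \<subseteq> C})"
    by (auto simp: partial_colorings_def)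
  then show ?thesis
    using assms by (auto intro!: finite_set_of_finite_maps intro: finite_subset)
qed

lemma partial_colorings_empty [simp]: "partial_colorings {} C = {Map.empty}"
  by (auto simp: partial_colorings_def)

lemma partial_colorings_insert:
  assumes "e \<notin> E"
  shows "partial_colorings (insert e E) C = partial_colorings E C \<union> (\<lambda>(c, f). f(e \<mapsto> c)) ` (C \<times> partial_colorings E C)"
proof (intro equalityI subsetI)
  fix f assume f: "f \<in> partial_colorings (insert e E) C"
  show "f \<in> partial_colorings E C \<union> (\<lambda>(c, f). f(e \<mapsto> c)) ` (C \<times> partial_colorings E C)"
  proof (cases "f e")
    case None
    with f show ?thesis by (fastforce simp: partial_colorings_def)
  next
    case (Some c)
    have "f = (f(e := None))(e \<mapsto> c)" using Some by auto
    moreover have "c \<in> C" using f Some by (auto simp: partial_colorings_def ran_def)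
    moreover have "f(e := None) \<in> partial_colorings E C"
      using f by (auto simp: partial_colorings_def ran_def split: if_splits)
    ultimately have "(c, f(e := None)) \<in> C \<times> partial_colorings E C" "f = (\<lambda>(c, f). f(e \<mapsto> c)) (c, f(e := None))"
      by auto
    then show ?thesis by (intro UnI2) (rule image_eqI)
  qed
next
  fix f assume "f \<in> partial_colorings E C \<union> (\<lambda>(c, f). f(e \<mapsto> c)) ` (C \<times> partial_colorings E C)"
  then show "f \<in> partial_colorings (insert e E) C"
  proof
    assume "f \<in> (\<lambda>(c, f). f(e \<mapsto> c)) ` (C \<times> partial_colorings E C)"
    then obtain c g where f: "f = g(e \<mapsto> c)" "c \<in> C" "g \<in> partial_colorings E C" by auto
    have "dom f \<subseteq> insert e (dom g)" "ran f \<subseteq> insert c (ran g)"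
      by (auto simp: f(1) ran_def)
    then show ?thesis using f by (auto simp: partial_colorings_def)
  qed (auto simp: partial_colorings_def)
qed

text \<open>Independence of the colour of one element from the others: every induction over \<open>E\<close> goes
  through this factorisation.\<close>
lemma avg_insert:
  assumes "finite E" "finite C" "e \<notin> E"
  shows "avg x (insert e E) C g = color_avg x C (\<lambda>y. avg x E C (\<lambda>f. g (f(e := y))))"
proof -
  let ?u = "\<lambda>(c, f). f(e \<mapsto> c)"
  have none: "f e = None" "f(e := None) = f" "finite (dom f)" "dom f \<subseteq> E" if "f \<in> partial_colorings E C" for f
  proof -
    have "dom f \<subseteq> E" using that by (simp add: partial_colorings_def)
    moreover from this have "f e = None" using assms by (auto simp: domIff)
    ultimately show "f e = None" "f(e := None) = f" "finite (dom f)" "dom f \<subseteq> E"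
      using assms by (auto intro: finite_subset)
  qed
  have disj: "partial_colorings E C \<inter> ?u ` (C \<times> partial_colorings E C) = {}"
    using none by auto (metis none(1) fun_upd_same option.distinct(1))
  have inj: "inj_on ?u (C \<times> partial_colorings E C)"
  proof (rule inj_onI, clarsimp)
    fix c f c' f' assume f: "f \<in> partial_colorings E C" "f' \<in> partial_colorings E C" and eq: "f(e \<mapsto> c) = f'(e \<mapsto> c')"
    have "c = c'" using fun_cong[OF eq, of e] by simp
    moreover have "f = f'"
    proof
      fix y show "f y = f' y"
        using fun_cong[OF eq, of y] none(1)[OF f(1)] none(1)[OF f(2)] by (cases "y = e") auto
    qed
    ultimately show "c = c' \<and> f = f'" by simp
  qed
  have m0: "mass x (insert e E) C f = (1 - real (card C) * x) * mass x E C f" if "f \<in> partial_colorings E C" for f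
  proof -
    have "insert e E - dom f = insert e (E - dom f)" using none[OF that] by (auto simp: dom_def)
    then show ?thesis using assms by (simp add: mass_def)
  qed
  have m1: "mass x (insert e E) C (f(e \<mapsto> c)) = x * mass x E C f" if "f \<in> partial_colorings E C" for f c
  proof -
    have "insert e E - dom (f(e \<mapsto> c)) = E - dom f" using assms by auto
    moreover have "card (dom (f(e \<mapsto> c))) = Suc (card (dom f))"
      using none[OF that] assms by (simp add: domIff)
    ultimately show ?thesis by (simp add: mass_def)
  qed
  have "avg x (insert e E) C g = (\<Sum>f\<in>partial_colorings E C. mass x (insert e E) C f * g f)
      + (\<Sum>f\<in>?u ` (C \<times> partial_colorings E C). mass x (insert e E) C f * g f)"
    unfolding avg_def partial_colorings_insert[OF assms(3)] using disj assms
    by (intro sum.union_disjoint) (auto simp: finite_partial_colorings)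
  also have "(\<Sum>f\<in>?u ` (C \<times> partial_colorings E C). mass x (insert e E) C f * g f)
     = (\<Sum>(c,f)\<in>C \<times> partial_colorings E C. x * (mass x E C f * g (f(e \<mapsto> c))))"
    by (subst sum.reindex[OF inj], intro sum.cong) (auto simp: m1)
  also have "\<dots> = x * (\<Sum>c\<in>C. avg x E C (\<lambda>f. g (f(e \<mapsto> c))))"
    by (simp add: avg_def sum.cartesian_product sum_distrib_left case_prod_unfold)
  also have "(\<Sum>f\<in>partial_colorings E C. mass x (insert e E) C f * g f)
      = (1 - real (card C) * x) * avg x E C (\<lambda>f. g (f(e := None)))"
    unfolding avg_def sum_distrib_left by (intro sum.cong) (auto simp: m0 none mult.assoc)
  finally show ?thesis by (simp only: color_avg_def)
qed

lemma avg_empty [simp]: "avg x {} C g = g Map.empty"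
  by (simp add: avg_def mass_def)

lemma color_avg_const [simp]: "finite C \<Longrightarrow> color_avg x C (\<lambda>_. a) = a"
  by (simp add: color_avg_def algebra_simps)

lemma avg_const [simp]: "finite E \<Longrightarrow> finite C \<Longrightarrow> avg x E C (\<lambda>_. a) = a"
  by (induction E rule: finite_induct) (auto simp: avg_insert)

lemma avg_cong: "(\<And>f. f \<in> partial_colorings E C \<Longrightarrow> g f = h f) \<Longrightarrow> avg x E C g = avg x E C h"
  unfolding avg_def by (intro sum.cong) auto

lemma mass_nonneg: "0 \<le> x \<Longrightarrow> real (card C) * x \<le> 1 \<Longrightarrow> 0 \<le> mass x E C f"
  by (simp add: mass_def)

lemma avg_mono:
  "0 \<le> x \<Longrightarrow> real (card C) * x \<le> 1 \<Longrightarrow> (\<And>f. f \<in> partial_colorings E C \<Longrightarrow> g f \<le> h f) \<Longrightarrow> avg x E C g \<le> avg x E C h"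
  unfolding avg_def by (intro sum_mono mult_left_mono) (auto simp: mass_nonneg)

lemma color_avg_mono:
  "0 \<le> x \<Longrightarrow> real (card C) * x \<le> 1 \<Longrightarrow> (\<And>y. g y \<le> h y) \<Longrightarrow> color_avg x C g \<le> color_avg x C h"
  unfolding color_avg_def by (intro add_mono mult_left_mono sum_mono) auto

lemma avg_add: "avg x E C (\<lambda>f. g f + h f) = avg x E C g + avg x E C h"
  by (simp add: avg_def sum.distrib algebra_simps)

lemma avg_diff: "avg x E C (\<lambda>f. g f - h f) = avg x E C g - avg x E C h"
  by (simp add: avg_def sum_subtractf algebra_simps)

lemma avg_cmult: "avg x E C (\<lambda>f. a * g f) = a * avg x E C g"
  by (simp add: avg_def sum_distrib_left mult.left_commute)

lemma avg_sum: "avg x E C (\<lambda>f. \<Sum>i\<in>I. g i f) = (\<Sum>i\<in>I. avg x E C (g i))"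
  unfolding avg_def sum_distrib_left by (rule sum.swap)

lemma avg_color_avg_swap: "avg x E C (\<lambda>f. color_avg y C (g f)) = color_avg y C (\<lambda>z. avg x E C (\<lambda>f. g f z))"
  by (simp add: color_avg_def avg_add avg_cmult avg_sum)

lemma color_avg_add: "color_avg x C (\<lambda>f. g f + h f) = color_avg x C g + color_avg x C h"
  by (simp add: color_avg_def sum.distrib algebra_simps)

section \<open>Planting\<close>

text \<open>Writing the colour \<open>c\<close> over whatever \<open>e\<close> had is the same as conditioning on \<open>e\<close> having
  colour \<open>c\<close>, an event of probability \<open>x\<close>.\<close>
lemma avg_plant1:
  assumes "finite E" "finite C" "e \<in> E" "c \<in> C"
  shows "x * avg x E C (\<lambda>f. g (f(e \<mapsto> c))) = avg x E C (\<lambda>f. if f e = Some c then g f else 0)"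
proof -
  define E' where "E' = E - {e}"
  have E: "E = insert e E'" "e \<notin> E'" "finite E'" using assms by (auto simp: E'_def)
  have "(\<Sum>d\<in>C. if d = c then avg x E' C (\<lambda>f. g (f(e \<mapsto> c))) else 0)
      = (\<Sum>d\<in>C. avg x E' C (\<lambda>f. if d = c then g (f(e \<mapsto> d)) else 0))"
    using E assms(2) by (intro sum.cong) auto
  then show ?thesis
    using assms E by (simp add: avg_insert color_avg_def sum.delta' algebra_simps cong: if_cong)
qed

definition plant :: "('e \<times> 'c) set \<Rightarrow> ('e \<rightharpoonup> 'c) \<Rightarrow> ('e \<rightharpoonup> 'c)" where
  "plant T f = (\<lambda>e. if e \<in> Domain T then Some (THE c. (e, c) \<in> T) else f e)"

lemma graph_iff: "(e, c) \<in> Map.graph f \<longleftrightarrow> f e = Some c"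
  by (auto simp: Map.graph_def)

lemma graph_plant:
  assumes "single_valued T"
  shows "Map.graph (plant T f) = T \<union> {p \<in> Map.graph f. fst p \<notin> Domain T}"
proof -
  have "(THE c. (e, c) \<in> T) = d" if "(e, d) \<in> T" for e d
    using assms that by (auto simp: single_valued_def)
  then show ?thesis
    by (auto simp: graph_iff plant_def split: if_splits)
qed

text \<open>This replaces the map \<open>(W, T) \<mapsto> W \<union> T\<close> of the usual argument for independent sets, where the
  factor would be \<open>(x / (1 - x))\<^sup>t\<close>. It is used with \<open>g\<close> the indicator of a property of
  the overwritten colouring.\<close>
lemma avg_plant:
  assumes "finite E" "finite C" "finite T" "single_valued T" "T \<subseteq> E \<times> C"
  shows "x ^ card T * avg x E C (\<lambda>f. g (plant T f))
       = avg x E C (\<lambda>f. if T \<subseteq> Map.graph f then g f else 0)"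
  using assms(3-5)
proof (induction T arbitrary: g rule: finite_induct)
  case empty
  then show ?case by (simp add: plant_def)
next
  case (insert p T)
  obtain e c where p: "p = (e, c)" by force
  have sv: "single_valued T" using insert.prems(1) by (auto simp: single_valued_def)
  have e: "e \<notin> Domain T"
    using insert.prems(1) insert.hyps(2) p by (auto simp: single_valued_def)
  have the: "(THE d. (e, d) \<in> insert (e, c) T) = c"
    using e by auto
  have pl: "plant (insert p T) f = (plant T f)(e \<mapsto> c)" for f
    using e by (auto simp: p plant_def the fun_eq_iff intro!: arg_cong[where f=The])
  have sub: "T \<subseteq> Map.graph (f(e \<mapsto> c)) \<longleftrightarrow> T \<subseteq> Map.graph f" for f
    using e by (auto simp: Map.graph_def subset_iff)
  have "x ^ card (insert p T) * avg x E C (\<lambda>f. g (plant (insert p T) f))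
      = x * (x ^ card T * avg x E C (\<lambda>f. g ((plant T f)(e \<mapsto> c))))"
    using insert.hyps by (simp add: pl)
  also have "\<dots> = x * avg x E C (\<lambda>f. if T \<subseteq> Map.graph f then g (f(e \<mapsto> c)) else 0)"
    using insert.IH[of "\<lambda>f. g (f(e \<mapsto> c))"] sv insert.prems by simp
  also have "\<dots> = x * avg x E C (\<lambda>f. (\<lambda>f. if T \<subseteq> Map.graph f then g f else 0) (f(e \<mapsto> c)))"
    by (simp only: sub)
  also have "\<dots> = avg x E C (\<lambda>f. if f e = Some c then if T \<subseteq> Map.graph f then g f else 0 else 0)"
    using assms insert.prems p by (intro avg_plant1) auto
  also have "\<dots> = avg x E C (\<lambda>f. if insert p T \<subseteq> Map.graph f then g f else 0)"
    by (intro avg_cong) (auto simp: p graph_iff)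
  finally show ?case .
qed

section \<open>Two rounds against one\<close>

text \<open>The exchange for a single element: \<open>A\<close> is the set of colours that complete a target set when the
  colours of all other elements are known, and \<open>P\<close> says that some target set is already complete
  without this element. The left side is at most the sum of two probabilities, and the right side
  equals it because one element cannot have two colours.\<close>
lemma color_avg_union_le:
  assumes "finite C" "0 \<le> x" "0 \<le> y" "real (card C) * (x + y) \<le> 1" "A \<subseteq> C"
  shows "color_avg x C (\<lambda>a. color_avg y C (\<lambda>b. of_bool (P \<or> (\<exists>c\<in>A. a = Some c \<or> b = Some c))))
       \<le> color_avg (x + y) C (\<lambda>d. of_bool (P \<or> (\<exists>c\<in>A. d = Some c)))"
proof (cases P)
  case True
  then show ?thesis using assms by simp
next
  case False
  have nx: "real (card C) * x \<le> 1" "real (card C) * y \<le> 1"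
    using assms by (auto simp: algebra_simps intro: order_trans[rotated])
  have cA: "(\<Sum>c\<in>C. of_bool (\<exists>d\<in>A. c = d)) = real (card A)"
    using assms by (simp add: Int_absorb1)
  have 1: "color_avg z C (\<lambda>d. of_bool (\<exists>c\<in>A. d = Some c)) = z * card A" for z
    using cA by (simp add: color_avg_def)
  have "color_avg x C (\<lambda>a. color_avg y C (\<lambda>b. of_bool (\<exists>c\<in>A. a = Some c \<or> b = Some c)))
     \<le> color_avg x C (\<lambda>a. color_avg y C (\<lambda>b. of_bool (\<exists>c\<in>A. a = Some c) + of_bool (\<exists>c\<in>A. b = Some c)))"
    using assms nx by (intro color_avg_mono) auto
  also have "\<dots> = (x + y) * card A"
    using assms by (simp add: color_avg_add 1 algebra_simps)
  finally show ?thesis using False by (simp add: 1)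
qed

text \<open>Since no set in \<open>F\<close> asks for two colours on the same element, having two colours available
  is of no advantage beyond the higher chance of each. Two independent rounds can therefore be replaced
  by a single partial colouring of the total density, which has one colour for each element.\<close>
lemma two_round_le_one_round:
  assumes "finite E" "finite C" "0 \<le> x" "0 \<le> y" "real (card C) * (x + y) \<le> 1"
    and "\<And>S. S \<in> F \<Longrightarrow> single_valued S"
  shows "avg x E C (\<lambda>f. avg y E C (\<lambda>g. of_bool (\<exists>S\<in>F. S \<subseteq> Map.graph f \<union> Map.graph g)))
       \<le> avg (x + y) E C (\<lambda>h. of_bool (\<exists>S\<in>F. S \<subseteq> Map.graph h))"
  using assms(1,6)
proof (induction E arbitrary: F rule: finite_induct)
  case empty
  then show ?case by simp
next
  case (insert e E)
  have nx: "real (card C) * x \<le> 1" "real (card C) * y \<le> 1"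
    using assms by (auto simp: algebra_simps intro: order_trans[rotated])
  \<comment> \<open>\<open>Fz z\<close> is what remains to be found outside \<open>e\<close> once \<open>e\<close> has received \<open>z\<close>.\<close>
  define del :: "('a \<times> 'b) set \<Rightarrow> ('a \<times> 'b) set" where "del S = {p \<in> S. fst p \<noteq> e}" for S
  define Fz where "Fz z = del ` {S \<in> F. \<forall>c. (e, c) \<in> S \<longrightarrow> z = Some c}" for z
  have svz: "S \<in> Fz z \<Longrightarrow> single_valued S" for S z
    using insert.prems by (auto simp: Fz_def del_def single_valued_def)
  have sub1: "S \<subseteq> Map.graph (h(e := z)) \<longleftrightarrow> (\<forall>c. (e, c) \<in> S \<longrightarrow> z = Some c) \<and> del S \<subseteq> Map.graph h" for S h z
    by (auto simp: del_def Map.graph_def subset_iff)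
  have rhs1: "(\<exists>S\<in>F. S \<subseteq> Map.graph (h(e := z))) \<longleftrightarrow> (\<exists>T\<in>Fz z. T \<subseteq> Map.graph h)" for h z
    by (auto simp: sub1 Fz_def)
  have point: "color_avg x C (\<lambda>a. color_avg y C (\<lambda>b. of_bool (\<exists>S\<in>F. S \<subseteq> Map.graph (f(e := a)) \<union> Map.graph (g(e := b)))))
     \<le> color_avg (x + y) C (\<lambda>z. of_bool (\<exists>T\<in>Fz z. T \<subseteq> Map.graph f \<union> Map.graph g))"
    if fg: "f \<in> partial_colorings E C" "g \<in> partial_colorings E C" for f g
  proof -
    let ?U = "Map.graph f \<union> Map.graph g"
    define P where "P \<longleftrightarrow> (\<exists>S\<in>F. e \<notin> Domain S \<and> del S \<subseteq> ?U)"
    define A where "A = {c. \<exists>S\<in>F. (e, c) \<in> S \<and> del S \<subseteq> ?U}"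
    have sv: "(e, c) \<in> S \<Longrightarrow> (e, d) \<in> S \<Longrightarrow> c = d" if "S \<in> F" for S c d
      using insert.prems that by (auto simp: single_valued_def)
    have r: "(\<exists>T\<in>Fz z. T \<subseteq> ?U) \<longleftrightarrow> P \<or> (\<exists>c\<in>A. z = Some c)" for z
    proof
      assume "\<exists>T\<in>Fz z. T \<subseteq> ?U"
      then show "P \<or> (\<exists>c\<in>A. z = Some c)"
        by (auto simp: P_def A_def Fz_def)
    next
      assume "P \<or> (\<exists>c\<in>A. z = Some c)"
      then show "\<exists>T\<in>Fz z. T \<subseteq> ?U"
        by (auto simp: P_def A_def Fz_def dest: sv)
    qed
    have l: "(\<exists>S\<in>F. S \<subseteq> Map.graph (f(e := a)) \<union> Map.graph (g(e := b)))
        \<longleftrightarrow> P \<or> (\<exists>c\<in>A. a = Some c \<or> b = Some c)" for a b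
    proof -
      have split: "S \<subseteq> Map.graph (f(e := a)) \<union> Map.graph (g(e := b)) \<longleftrightarrow>
        del S \<subseteq> ?U \<and> (\<forall>c. (e, c) \<in> S \<longrightarrow> a = Some c \<or> b = Some c)" for S
        by (auto simp: del_def Map.graph_def subset_iff)
      show ?thesis
      proof
        assume "\<exists>S\<in>F. S \<subseteq> Map.graph (f(e := a)) \<union> Map.graph (g(e := b))"
        then obtain S where S: "S \<in> F" "del S \<subseteq> ?U" "\<And>c. (e, c) \<in> S \<Longrightarrow> a = Some c \<or> b = Some c"
          unfolding split by metis
        show "P \<or> (\<exists>c\<in>A. a = Some c \<or> b = Some c)"
        proof (cases "e \<in> Domain S")
          case True
          then obtain c where "(e, c) \<in> S" by auto
          with S have "c \<in> A" "a = Some c \<or> b = Some c" unfolding A_def by blast+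
          then show ?thesis by metis
        next
          case False
          with S have P unfolding P_def by metis
          then show ?thesis ..
        qed
      next
        assume "P \<or> (\<exists>c\<in>A. a = Some c \<or> b = Some c)"
        then show "\<exists>S\<in>F. S \<subseteq> Map.graph (f(e := a)) \<union> Map.graph (g(e := b))"
        proof
          assume P
          then obtain S where "S \<in> F" "e \<notin> Domain S" "del S \<subseteq> ?U" unfolding P_def by metis
          then show ?thesis unfolding split by (meson Domain.intros)
        next
          assume "\<exists>c\<in>A. a = Some c \<or> b = Some c"
          then obtain c S where "a = Some c \<or> b = Some c" "S \<in> F" "(e, c) \<in> S" "del S \<subseteq> ?U"
            unfolding A_def by blast
          moreover from this have "\<And>d. (e, d) \<in> S \<Longrightarrow> d = c" by (meson sv)
          ultimately show ?thesis unfolding split by metis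
        qed
      qed
    qed
    have eq1: "color_avg w C g = color_avg w C h" if "\<And>z. z \<in> insert None (Some ` C) \<Longrightarrow> g z = h z" for g h w
      using that by (auto simp: color_avg_def intro!: sum.cong)
    have "color_avg x C (\<lambda>a. color_avg y C (\<lambda>b. of_bool (P \<or> (\<exists>c\<in>A. a = Some c \<or> b = Some c))))
      = color_avg x C (\<lambda>a. color_avg y C (\<lambda>b. of_bool (P \<or> (\<exists>c\<in>A \<inter> C. a = Some c \<or> b = Some c))))"
      by (intro eq1 arg_cong[where f=of_bool]) auto
    also have "\<dots> \<le> color_avg (x + y) C (\<lambda>d. of_bool (P \<or> (\<exists>c\<in>A \<inter> C. d = Some c)))"
      using assms by (intro color_avg_union_le) auto
    also have "\<dots> = color_avg (x + y) C (\<lambda>d. of_bool (P \<or> (\<exists>c\<in>A. d = Some c)))"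
      by (intro eq1 arg_cong[where f=of_bool]) auto
    finally show ?thesis by (simp add: l r)
  qed
  have "avg x (insert e E) C (\<lambda>f. avg y (insert e E) C (\<lambda>g. of_bool (\<exists>S\<in>F. S \<subseteq> Map.graph f \<union> Map.graph g)))
     = avg x E C (\<lambda>f. avg y E C (\<lambda>g.
         color_avg x C (\<lambda>a. color_avg y C (\<lambda>b. of_bool (\<exists>S\<in>F. S \<subseteq> Map.graph (f(e := a)) \<union> Map.graph (g(e := b)))))))"
    using insert.hyps assms(2) by (simp add: avg_insert avg_color_avg_swap[symmetric])
  also have "\<dots> \<le> avg x E C (\<lambda>f. avg y E C (\<lambda>g.
        color_avg (x + y) C (\<lambda>z. of_bool (\<exists>T\<in>Fz z. T \<subseteq> Map.graph f \<union> Map.graph g))))"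
    using nx assms by (intro avg_mono point) auto
  also have "\<dots> = color_avg (x + y) C (\<lambda>z. avg x E C (\<lambda>f. avg y E C (\<lambda>g.
        of_bool (\<exists>T\<in>Fz z. T \<subseteq> Map.graph f \<union> Map.graph g))))"
    by (simp add: avg_color_avg_swap)
  also have "\<dots> \<le> color_avg (x + y) C (\<lambda>z. avg (x + y) E C (\<lambda>h. of_bool (\<exists>T\<in>Fz z. T \<subseteq> Map.graph h)))"
    using assms by (intro color_avg_mono insert.IH svz) auto
  also have "\<dots> = avg (x + y) (insert e E) C (\<lambda>h. of_bool (\<exists>S\<in>F. S \<subseteq> Map.graph h))"
    using insert.hyps assms(2) by (simp add: avg_insert rhs1)
  finally show ?case .
qed

section \<open>Fragments of spread families\<close>

definition containment_prob :: "real \<Rightarrow> 'e set \<Rightarrow> 'c set \<Rightarrow> 's set \<Rightarrow> ('s \<Rightarrow> ('e \<times> 'c) set) \<Rightarrow> real" where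
  "containment_prob x E C G \<phi> = avg x E C (\<lambda>f. of_bool (\<exists>s\<in>G. \<phi> s \<subseteq> Map.graph f))"

text \<open>With \<open>N = card G\<close>, the last condition says that the uniform distribution on the family
  \<open>\<phi>\<close> indexed by \<open>G\<close> is \<open>q\<close>-spread. The reference count \<open>N\<close> is not tied to \<open>card G\<close>: after a
  round some indices are discarded, while the bounds on the numbers of supersets, and hence \<open>N\<close>, stay
  as they were.\<close>
definition spread ::
  "'e set \<Rightarrow> 'c set \<Rightarrow> real \<Rightarrow> real \<Rightarrow> nat \<Rightarrow> 's set \<Rightarrow> ('s \<Rightarrow> ('e \<times> 'c) set) \<Rightarrow> bool" where
  "spread E C N q l G \<phi> \<longleftrightarrow>
     finite G \<and> (\<forall>s\<in>G. \<phi> s \<subseteq> E \<times> C \<and> single_valued (\<phi> s) \<and> card (\<phi> s) \<le> l) \<and>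
     (\<forall>A. real (card {s \<in> G. A \<subseteq> \<phi> s}) \<le> N * q ^ card A)"

definition fragment :: "'s set \<Rightarrow> ('s \<Rightarrow> ('e \<times> 'c) set) \<Rightarrow> ('e \<rightharpoonup> 'c) \<Rightarrow> 's \<Rightarrow> ('e \<times> 'c) set" where
  "fragment G \<phi> W s =
     \<phi> (arg_min (\<lambda>u. card (\<phi> u - Map.graph W)) (\<lambda>u. u \<in> G \<and> \<phi> u \<subseteq> Map.graph W \<union> \<phi> s)) - Map.graph W"

text \<open>The candidates of size \<open>t\<close> for a fragment, seen from the overwritten colouring \<open>Z\<close> alone. It is
  empty if no member is contained in \<open>Z\<close>; without that clause the universal quantifier would be vacuous
  and every set of size \<open>t\<close> would be a candidate.\<close>
definition core :: "nat \<Rightarrow> 's set \<Rightarrow> ('s \<Rightarrow> ('e \<times> 'c) set) \<Rightarrow> ('e \<rightharpoonup> 'c) \<Rightarrow> ('e \<times> 'c) set set" where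
  "core t G \<phi> Z = {T. card T = t \<and> (\<exists>s\<in>G. \<phi> s \<subseteq> Map.graph Z) \<and>
                       (\<forall>s\<in>G. \<phi> s \<subseteq> Map.graph Z \<longrightarrow> T \<subseteq> \<phi> s)}"

lemma spread_finite: "finite E \<Longrightarrow> finite C \<Longrightarrow> spread E C N q l G \<phi> \<Longrightarrow> s \<in> G \<Longrightarrow> finite (\<phi> s)"
  by (rule finite_subset[of _ "E \<times> C"]) (auto simp: spread_def)

lemma fragment_obtain:
  assumes "s \<in> G"
  obtains u where "u \<in> G" "\<phi> u \<subseteq> Map.graph W \<union> \<phi> s" "fragment G \<phi> W s = \<phi> u - Map.graph W"
proof
  let ?P = "\<lambda>u. u \<in> G \<and> \<phi> u \<subseteq> Map.graph W \<union> \<phi> s"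
  have "?P (arg_min (\<lambda>u. card (\<phi> u - Map.graph W)) ?P)"
    by (rule arg_min_natI[of ?P s]) (use assms in auto)
  then show "arg_min (\<lambda>u. card (\<phi> u - Map.graph W)) ?P \<in> G"
    "\<phi> (arg_min (\<lambda>u. card (\<phi> u - Map.graph W)) ?P) \<subseteq> Map.graph W \<union> \<phi> s" by auto
qed (simp add: fragment_def)

lemma card_fragment_le:
  assumes "u \<in> G" "\<phi> u \<subseteq> Map.graph W \<union> \<phi> s"
  shows "card (fragment G \<phi> W s) \<le> card (\<phi> u - Map.graph W)"
  unfolding fragment_def by (rule arg_min_nat_le[where m="\<lambda>u. card (\<phi> u - Map.graph W)"]) (use assms in auto)

lemma fragment_subset:
  assumes "s \<in> G"
  shows "fragment G \<phi> W s \<subseteq> \<phi> s"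
  by (rule fragment_obtain[OF assms, of \<phi> W]) auto

text \<open>The member \<open>\<phi> u\<close> that realises the fragment \<open>T\<close> is contained in \<open>Z = plant T W\<close>: it is a partial
  function, so its part inside \<open>W\<close> avoids the elements that \<open>T\<close> overwrites. If \<open>\<phi> v\<close> is any member
  contained in \<open>Z\<close>, then \<open>\<phi> v - W\<close> is contained in \<open>T\<close> and competes in the minimisation, so it is
  all of \<open>T\<close>.\<close>
lemma fragment_core:
  fixes W :: "'e \<rightharpoonup> 'c"
  assumes "s \<in> G" "finite (\<phi> s)" "\<And>u. u \<in> G \<Longrightarrow> single_valued (\<phi> u)"
  defines "T \<equiv> fragment G \<phi> W s"
  shows "T \<in> core (card T) G \<phi> (plant T W)"
proof -
  have Ts: "T \<subseteq> \<phi> s" unfolding T_def by (rule fragment_subset[OF assms(1)])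
  then have svT: "single_valued T" "finite T"
    using assms(2) assms(3)[OF assms(1)] by (auto intro: single_valued_subset finite_subset)
  obtain u where u: "u \<in> G" "\<phi> u \<subseteq> Map.graph W \<union> \<phi> s" "T = \<phi> u - Map.graph W"
    unfolding T_def by (rule fragment_obtain[OF assms(1), of \<phi> W])
  have gp: "Map.graph (plant T W) = T \<union> {p \<in> Map.graph W. fst p \<notin> Domain T}"
    by (rule graph_plant[OF svT(1)])
  have "\<phi> u \<subseteq> Map.graph (plant T W)"
  proof
    fix p assume p: "p \<in> \<phi> u"
    obtain e c where [simp]: "p = (e, c)" by force
    show "p \<in> Map.graph (plant T W)"
    proof (cases "p \<in> T")
      case False
      then have "p \<in> Map.graph W" using p u(3) by auto
      moreover have "e \<notin> Domain T"
      proof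
        assume "e \<in> Domain T"
        then obtain d where d: "(e, d) \<in> T" by auto
        then have "(e, d) \<in> \<phi> u" using u(3) by auto
        then have "d = c" using p assms(3)[OF u(1)] by (auto simp: single_valued_def)
        then show False using d False by simp
      qed
      ultimately show ?thesis by (simp add: gp)
    qed (simp add: gp)
  qed
  moreover have "T \<subseteq> \<phi> v" if v: "v \<in> G" "\<phi> v \<subseteq> Map.graph (plant T W)" for v
  proof -
    have sub: "\<phi> v - Map.graph W \<subseteq> T" using v(2) gp by auto
    have "card T \<le> card (\<phi> v - Map.graph W)"
      unfolding T_def using v(2) gp Ts by (intro card_fragment_le v(1)) auto
    then have "\<phi> v - Map.graph W = T" using sub svT(2) by (metis card_seteq)
    then show ?thesis by auto
  qed
  ultimately show ?thesis using u(1) by (auto simp: core_def)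
qed

text \<open>All candidates are subsets of one and the same member.\<close>
lemma card_core:
  assumes "\<And>s. s \<in> G \<Longrightarrow> finite (\<phi> s) \<and> card (\<phi> s) \<le> l"
  shows "card (core t G \<phi> Z) \<le> l choose t"
proof (cases "\<exists>s\<in>G. \<phi> s \<subseteq> Map.graph Z")
  case True
  then obtain s where s: "s \<in> G" "\<phi> s \<subseteq> Map.graph Z" by auto
  have "core t G \<phi> Z \<subseteq> {T. T \<subseteq> \<phi> s \<and> card T = t}" using s by (auto simp: core_def)
  moreover have "finite {T. T \<subseteq> \<phi> s \<and> card T = t}"
    using assms[OF s(1)] by (auto intro: finite_subset[of _ "Pow (\<phi> s)"])
  ultimately have "card (core t G \<phi> Z) \<le> card {T. T \<subseteq> \<phi> s \<and> card T = t}"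
    by (rule card_mono[rotated])
  also have "\<dots> = card (\<phi> s) choose t" using assms[OF s(1)] by (simp add: n_subsets)
  also have "\<dots> \<le> l choose t" using assms[OF s(1)] by (intro binomial_right_mono) auto
  finally show ?thesis .
next
  case False
  then have "core t G \<phi> Z = {}" by (auto simp: core_def)
  then show ?thesis by simp
qed

text \<open>The counting step. An index with fragment \<open>T\<close> has \<open>T \<subseteq> \<phi> s\<close>, so by spreadness each fragment of
  size \<open>t\<close> serves at most \<open>N q\<^sup>t\<close> indices. The expected number of fragments of size \<open>t\<close> is at most
  \<open>(l choose t) / x\<^sup>t\<close>: planting converts the probability that \<open>T\<close> is a candidate for the overwritten
  colouring into the probability that it is one for the colouring itself, up to the factor \<open>x\<^sup>t\<close>, and
  then the candidates can be counted for each colouring separately.\<close>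
lemma fragment_count:
  assumes fin: "finite E" "finite C" and x: "0 < x" "real (card C) * x \<le> 1"
    and Nq: "0 \<le> N" "0 \<le> q" and sp: "spread E C N q l G \<phi>"
  shows "avg x E C (\<lambda>W. real (card {s \<in> G. card (fragment G \<phi> W s) = t}))
       \<le> N * (real (l choose t) * (q / x) ^ t)"
proof -
  define \<T> where "\<T> = {T. T \<subseteq> E \<times> C \<and> single_valued T \<and> card T = t}"
  have finT: "finite \<T>" using fin by (auto simp: \<T>_def intro: finite_subset[of _ "Pow (E \<times> C)"])
  have G: "finite G" "\<And>s. s \<in> G \<Longrightarrow> \<phi> s \<subseteq> E \<times> C" "\<And>s. s \<in> G \<Longrightarrow> single_valued (\<phi> s)"
    "\<And>s. s \<in> G \<Longrightarrow> finite (\<phi> s) \<and> card (\<phi> s) \<le> l"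
    and cnt: "\<And>A. real (card {s \<in> G. A \<subseteq> \<phi> s}) \<le> N * q ^ card A"
    using sp spread_finite[OF fin sp] unfolding spread_def by blast+
  have "real (card {s \<in> G. card (fragment G \<phi> W s) = t})
      \<le> (\<Sum>T\<in>\<T>. of_bool (T \<in> core t G \<phi> (plant T W)) * (N * q ^ t))" for W
  proof -
    let ?D = "{T \<in> \<T>. T \<in> core t G \<phi> (plant T W)}"
    have "{s \<in> G. card (fragment G \<phi> W s) = t} \<subseteq> (\<Union>T\<in>?D. {s \<in> G. T \<subseteq> \<phi> s})"
    proof
      fix s assume s: "s \<in> {s \<in> G. card (fragment G \<phi> W s) = t}"
      let ?T = "fragment G \<phi> W s"
      have "?T \<subseteq> \<phi> s" using s by (intro fragment_subset) auto
      moreover have "?T \<in> core t G \<phi> (plant ?T W)" using fragment_core[of s G \<phi> W] s G by auto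
      moreover have "?T \<in> \<T>"
        using s G(2,3)[of s] \<open>?T \<subseteq> \<phi> s\<close> single_valued_subset[of ?T "\<phi> s"]
        unfolding \<T>_def by blast
      ultimately show "s \<in> (\<Union>T\<in>?D. {s \<in> G. T \<subseteq> \<phi> s})" using s by blast
    qed
    then have "card {s \<in> G. card (fragment G \<phi> W s) = t} \<le> card (\<Union>T\<in>?D. {s \<in> G. T \<subseteq> \<phi> s})"
      using G(1) finT by (intro card_mono) auto
    also have "\<dots> \<le> (\<Sum>T\<in>?D. card {s \<in> G. T \<subseteq> \<phi> s})"
      using finT by (intro card_UN_le) auto
    finally have "real (card {s \<in> G. card (fragment G \<phi> W s) = t}) \<le> (\<Sum>T\<in>?D. real (card {s \<in> G. T \<subseteq> \<phi> s}))"
      by (simp flip: of_nat_sum)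
    also have "\<dots> \<le> (\<Sum>T\<in>?D. N * q ^ t)"
      using cnt by (intro sum_mono) (auto simp: \<T>_def)
    also have "\<dots> = (\<Sum>T\<in>\<T>. of_bool (T \<in> core t G \<phi> (plant T W)) * (N * q ^ t))"
      using finT by (simp add: Int_def flip: sum_distrib_right)
    finally show ?thesis .
  qed
  then have "avg x E C (\<lambda>W. real (card {s \<in> G. card (fragment G \<phi> W s) = t}))
     \<le> avg x E C (\<lambda>W. \<Sum>T\<in>\<T>. of_bool (T \<in> core t G \<phi> (plant T W)) * (N * q ^ t))"
    using x by (intro avg_mono) auto
  also have "\<dots> = (N * q ^ t) * (\<Sum>T\<in>\<T>. avg x E C (\<lambda>W. of_bool (T \<in> core t G \<phi> (plant T W))))"
    by (simp add: avg_sum mult.commute[of "of_bool _"] avg_cmult sum_distrib_left)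
  also have "(\<Sum>T\<in>\<T>. avg x E C (\<lambda>W. of_bool (T \<in> core t G \<phi> (plant T W))))
     = (\<Sum>T\<in>\<T>. avg x E C (\<lambda>W. if T \<subseteq> Map.graph W then of_bool (T \<in> core t G \<phi> W) else 0) / x ^ t)"
  proof (rule sum.cong[OF refl])
    fix T assume "T \<in> \<T>"
    then show "avg x E C (\<lambda>W. of_bool (T \<in> core t G \<phi> (plant T W)))
      = avg x E C (\<lambda>W. if T \<subseteq> Map.graph W then of_bool (T \<in> core t G \<phi> W) else 0) / x ^ t"
      using avg_plant[of E C T x "\<lambda>W. of_bool (T \<in> core t G \<phi> W)"] fin x
      by (auto simp: \<T>_def field_simps intro: finite_subset[of _ "E \<times> C"])
  qed
  also have "\<dots> \<le> (\<Sum>T\<in>\<T>. avg x E C (\<lambda>W. of_bool (T \<in> core t G \<phi> W)) / x ^ t)"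
    using x by (intro sum_mono divide_right_mono avg_mono) auto
  also have "\<dots> = avg x E C (\<lambda>W. \<Sum>T\<in>\<T>. of_bool (T \<in> core t G \<phi> W)) / x ^ t"
    by (simp add: avg_sum sum_divide_distrib)
  also have "\<dots> \<le> avg x E C (\<lambda>W. real (l choose t)) / x ^ t"
  proof (intro divide_right_mono avg_mono)
    fix W
    have "finite (core t G \<phi> W)"
    proof (cases "\<exists>s\<in>G. \<phi> s \<subseteq> Map.graph W")
      case True
      then obtain s where "s \<in> G" "\<phi> s \<subseteq> Map.graph W" by auto
      then have "core t G \<phi> W \<subseteq> Pow (\<phi> s)" by (auto simp: core_def)
      then show ?thesis using G(4)[OF \<open>s \<in> G\<close>] by (auto intro: finite_subset)
    next
      case False
      then have "core t G \<phi> W = {}" by (auto simp: core_def)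
      then show ?thesis by simp
    qed
    then have "card (\<T> \<inter> core t G \<phi> W) \<le> card (core t G \<phi> W)"
      by (intro card_mono) auto
    also have "\<dots> \<le> l choose t" by (rule card_core) (use G(4) in auto)
    finally show "(\<Sum>T\<in>\<T>. of_bool (T \<in> core t G \<phi> W)) \<le> real (l choose t)"
      using finT by (simp add: Int_def)
  qed (use x in auto)
  also have "\<dots> = real (l choose t) / x ^ t" using fin by simp
  finally have "avg x E C (\<lambda>W. real (card {s \<in> G. card (fragment G \<phi> W s) = t}))
     \<le> (N * q ^ t) * (real (l choose t) / x ^ t)"
    using Nq by (simp add: mult_left_mono)
  then show ?thesis by (simp add: power_divide mult_ac)
qed

text \<open>One round with density \<open>x\<close>. The indices whose fragments have size at most \<open>h\<close> form, with
  these fragments, a family with the same \<open>N\<close> and \<open>q\<close>, to which the remaining density \<open>y\<close> is applied;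
  a fragment that is found in the second exposure yields a member of the original family in the union of
  both. The proportion of discarded indices is bounded by \<open>fragment_count\<close>.\<close>
lemma spread_round:
  fixes \<phi> :: "'s \<Rightarrow> ('e \<times> 'c) set"
  assumes fin: "finite E" "finite C" and xy: "0 < x" "0 \<le> y" "real (card C) * (x + y) \<le> 1"
    and Nq: "0 < N" "0 \<le> q" and sp: "spread E C N q l G \<phi>"
    and next_round: "\<And>G' (\<phi>' :: 's \<Rightarrow> ('e \<times> 'c) set).
      spread E C N q h G' \<phi>' \<Longrightarrow> card G' / N - \<delta> \<le> containment_prob y E C G' \<phi>'"
  shows "card G / N - (\<delta> + (\<Sum>t\<in>{h<..l}. real (l choose t) * (q / x) ^ t)) \<le> containment_prob (x + y) E C G \<phi>"
proof -
  have cx: "real (card C) * x \<le> 1" "real (card C) * y \<le> 1"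
    using xy by (auto simp: algebra_simps intro: order_trans[rotated])
  define small where "small W = {s \<in> G. card (fragment G \<phi> W s) \<le> h}" for W
  define bad where "bad t W = {s \<in> G. card (fragment G \<phi> W s) = t}" for t W
  have G: "finite G" "\<And>s. s \<in> G \<Longrightarrow> \<phi> s \<subseteq> E \<times> C" "\<And>s. s \<in> G \<Longrightarrow> single_valued (\<phi> s)"
    "\<And>s. s \<in> G \<Longrightarrow> finite (\<phi> s)" "\<And>s. s \<in> G \<Longrightarrow> card (\<phi> s) \<le> l"
    and cnt: "\<And>A. real (card {s \<in> G. A \<subseteq> \<phi> s}) \<le> N * q ^ card A"
    using sp spread_finite[OF fin sp] unfolding spread_def by blast+
  have fr: "fragment G \<phi> W s \<subseteq> \<phi> s" if "s \<in> G" for s W using that by (rule fragment_subset)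
  have sp': "spread E C N q h (small W) (fragment G \<phi> W)" for W
    unfolding spread_def
  proof (intro conjI ballI allI)
    fix s assume s: "s \<in> small W"
    then have "s \<in> G" by (simp add: small_def)
    then show "fragment G \<phi> W s \<subseteq> E \<times> C" "single_valued (fragment G \<phi> W s)"
      using fr[of s W] G by (blast, blast intro: single_valued_subset)
    show "card (fragment G \<phi> W s) \<le> h" using s by (simp add: small_def)
  next
    fix A
    have "card {s \<in> small W. A \<subseteq> fragment G \<phi> W s} \<le> card {s \<in> G. A \<subseteq> \<phi> s}"
    proof (intro card_mono subsetI)
      fix s assume "s \<in> {s \<in> small W. A \<subseteq> fragment G \<phi> W s}"
      then have "s \<in> G" "A \<subseteq> fragment G \<phi> W s" by (auto simp: small_def)
      then show "s \<in> {s \<in> G. A \<subseteq> \<phi> s}" using fr[of s W] by blast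
    qed (use G in simp)
    then show "real (card {s \<in> small W. A \<subseteq> fragment G \<phi> W s}) \<le> N * q ^ card A"
      using cnt[of A] by linarith
  qed (use G in \<open>simp add: small_def\<close>)
  have cover: "card G \<le> card (small W) + (\<Sum>t\<in>{h<..l}. card (bad t W))" for W
  proof -
    have "G \<subseteq> small W \<union> (\<Union>t\<in>{h<..l}. bad t W)"
    proof
      fix s assume s: "s \<in> G"
      have "card (fragment G \<phi> W s) \<le> l"
        using card_mono[OF G(4)[OF s] fr[OF s, of W]] G(5)[OF s] by linarith
      then show "s \<in> small W \<union> (\<Union>t\<in>{h<..l}. bad t W)"
        using s by (auto simp: small_def bad_def not_le)
    qed
    then have "card G \<le> card (small W \<union> (\<Union>t\<in>{h<..l}. bad t W))"
      using G(1) by (intro card_mono) (auto simp: small_def bad_def)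
    also have "\<dots> \<le> card (small W) + card (\<Union>t\<in>{h<..l}. bad t W)" by (rule card_Un_le)
    also have "card (\<Union>t\<in>{h<..l}. bad t W) \<le> (\<Sum>t\<in>{h<..l}. card (bad t W))"
      by (rule card_UN_le) simp
    finally show ?thesis by simp
  qed
  have "card G / N - (\<Sum>t\<in>{h<..l}. real (l choose t) * (q / x) ^ t)
     \<le> card G / N - (\<Sum>t\<in>{h<..l}. avg x E C (\<lambda>W. real (card (bad t W))) / N)"
  proof (intro diff_left_mono sum_mono)
    fix t
    show "avg x E C (\<lambda>W. real (card (bad t W))) / N \<le> real (l choose t) * (q / x) ^ t"
      using fragment_count[OF fin xy(1) cx(1) _ Nq(2) sp, of t] Nq
      by (simp add: bad_def divide_le_eq mult_ac)
  qed
  also have "\<dots> = avg x E C (\<lambda>W. (real (card G) - (\<Sum>t\<in>{h<..l}. real (card (bad t W)))) / N)"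
    using fin by (simp add: avg_diff avg_sum divide_inverse mult.commute[of _ "inverse N"] avg_cmult
        right_diff_distrib sum_distrib_left)
  also have "\<dots> \<le> avg x E C (\<lambda>W. \<delta> + containment_prob y E C (small W) (fragment G \<phi> W))"
  proof (intro avg_mono cx(1))
    fix W
    have "(real (card G) - (\<Sum>t\<in>{h<..l}. real (card (bad t W)))) / N \<le> card (small W) / N"
      using cover[of W] Nq by (intro divide_right_mono) (simp_all flip: of_nat_sum)
    also have "\<dots> \<le> \<delta> + containment_prob y E C (small W) (fragment G \<phi> W)"
      using next_round[OF sp'[of W]] by simp
    finally show "(real (card G) - (\<Sum>t\<in>{h<..l}. real (card (bad t W)))) / N
        \<le> \<delta> + containment_prob y E C (small W) (fragment G \<phi> W)" .
  qed (use xy in auto)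
  also have "\<dots> = \<delta> + avg x E C (\<lambda>W. containment_prob y E C (small W) (fragment G \<phi> W))"
    using fin by (simp add: avg_add)
  also have "avg x E C (\<lambda>W. containment_prob y E C (small W) (fragment G \<phi> W))
     \<le> avg x E C (\<lambda>W. avg y E C (\<lambda>g. of_bool (\<exists>S\<in>\<phi> ` G. S \<subseteq> Map.graph W \<union> Map.graph g)))"
    unfolding containment_prob_def
  proof (intro avg_mono)
    fix W g
    have "\<exists>S\<in>\<phi> ` G. S \<subseteq> Map.graph W \<union> Map.graph g"
      if "s \<in> small W" "fragment G \<phi> W s \<subseteq> Map.graph g" for s
    proof -
      have "s \<in> G" using that by (simp add: small_def)
      then obtain u where "u \<in> G" "fragment G \<phi> W s = \<phi> u - Map.graph W" by (rule fragment_obtain)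
      then show ?thesis using that(2) by blast
    qed
    then show "of_bool (\<exists>s\<in>small W. fragment G \<phi> W s \<subseteq> Map.graph g)
      \<le> (of_bool (\<exists>S\<in>\<phi> ` G. S \<subseteq> Map.graph W \<union> Map.graph g) :: real)"
      by auto
  qed (use xy cx in auto)
  also have "\<dots> \<le> avg (x + y) E C (\<lambda>h. of_bool (\<exists>S\<in>\<phi> ` G. S \<subseteq> Map.graph h))"
    using xy G(3) by (intro two_round_le_one_round fin) auto
  also have "\<dots> = containment_prob (x + y) E C G \<phi>" by (simp add: containment_prob_def)
  finally show ?thesis by simp
qed

text \<open>The recursion ends with sets of size \<open>0\<close>: a single surviving index is enough, so the
  containment probability is \<open>0\<close> or \<open>1\<close>, and it is at least the surviving proportion.\<close>
lemma containment_prob_empty: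
  assumes "finite E" "finite C" "0 < N" "spread E C N q 0 G \<phi>"
  shows "card G / N \<le> containment_prob 0 E C G \<phi>"
proof (cases "G = {}")
  case True
  then show ?thesis using assms by (simp add: containment_prob_def)
next
  case False
  have "\<phi> s = {}" if "s \<in> G" for s
    using assms that by (auto simp: spread_def dest!: bspec finite_subset[of _ "E \<times> C"])
  then have "(\<exists>s\<in>G. \<phi> s \<subseteq> Map.graph f) \<longleftrightarrow> True" for f using False by auto
  then have "containment_prob 0 E C G \<phi> = 1" using assms by (simp add: containment_prob_def)
  moreover have "{s \<in> G. {} \<subseteq> \<phi> s} = G" by auto
  then have "real (card G) \<le> N" using assms(4) unfolding spread_def
    by (metis card.empty mult.right_neutral power_0)
  ultimately show ?thesis using assms by (simp add: divide_le_eq)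
qed

lemma sum_choose_power_le:
  fixes z :: real
  assumes "0 \<le> z"
  shows "(\<Sum>t\<in>{0<..l}. real (l choose t) * z ^ t) \<le> (1 + z) ^ l - 1"
proof -
  have "(1 + z) ^ l = (\<Sum>t\<le>l. real (l choose t) * z ^ t)"
    using binomial_ring[of z 1 l] by (simp add: add.commute)
  also have "{..l} = insert 0 {0<..l}" by auto
  also have "(\<Sum>t\<in>insert 0 {0<..l}. real (l choose t) * z ^ t) = 1 + (\<Sum>t\<in>{0<..l}. real (l choose t) * z ^ t)"
    by (subst sum.insert) auto
  finally show ?thesis by simp
qed

text \<open>The constant \<open>64\<close> makes the factor \<open>64\<^sup>-\<^sup>h = 8\<^sup>-\<^sup>2\<^sup>h\<close> beat the \<open>2\<^sup>2\<^sup>h\<close> subsets.\<close>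
lemma sum_choose_upper_half_le: "(\<Sum>t\<in>{h<..2 * h}. real ((2 * h) choose t) * (1 / 64) ^ t) \<le> (1 / 4) ^ (2 * h)"
proof -
  have "(\<Sum>t\<in>{h<..2 * h}. real ((2 * h) choose t) * (1 / 64) ^ t) \<le> (\<Sum>t\<in>{h<..2 * h}. real ((2 * h) choose t) * (1 / 64) ^ h)"
    by (intro sum_mono mult_left_mono power_decreasing) auto
  also have "\<dots> \<le> (\<Sum>t\<le>2 * h. real ((2 * h) choose t) * (1 / 64) ^ h)"
    by (intro sum_mono2) auto
  also have "\<dots> = 2 ^ (2 * h) * (1 / 64) ^ h"
  proof -
    have "(\<Sum>t\<le>2 * h. real ((2 * h) choose t)) = 2 ^ (2 * h)"
      using arg_cong[OF choose_row_sum[of "2 * h"], of real] by simp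
    then show ?thesis by (simp only: flip: sum_distrib_right)
  qed
  also have "\<dots> = (1 / 4) ^ (2 * h)"
  proof -
    have "(2 :: real) ^ (2 * h) * (1 / 64) ^ h = (2 ^ 2 * (1 / 64)) ^ h"
      by (simp only: power_mult power_mult_distrib)
    also have "\<dots> = ((1 / 4) ^ 2) ^ h" by (simp add: power2_eq_square)
    finally show ?thesis by (simp only: power_mult)
  qed
  finally show ?thesis .
qed

text \<open>There are \<open>r\<close> halving rounds of density \<open>64 q\<close>, from size \<open>a 2\<^sup>r\<close> down to \<open>a\<close>, and a last
  round of density \<open>q \<Lambda>\<close> that must remove everything. The errors of the halving rounds are
  exponentially small in the current size, hence at most \<open>4\<^sup>-\<^sup>a\<close> each. In the last round the error
  is small once \<open>\<Lambda>\<close> is large compared with \<open>a\<close>; this is why the halving stops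
  at \<open>a\<close> rather than going down to \<open>1\<close>, where the errors would no longer be small.\<close>
theorem spread_threshold:
  fixes \<phi> :: "'s \<Rightarrow> ('e \<times> 'c) set"
  assumes fin: "finite E" "finite C" and Nq: "0 < N" "0 < q" and L: "0 < \<Lambda>"
    and "real (card C) * (q * (\<Lambda> + 64 * real r)) \<le> 1" and "spread E C N q (a * 2 ^ r) G \<phi>"
  shows "card G / N - ((1 + 1 / \<Lambda>) ^ a - 1 + real r * (1 / 4) ^ a) \<le> containment_prob (q * (\<Lambda> + 64 * real r)) E C G \<phi>"
  using assms(6,7)
proof (induction r arbitrary: G \<phi>)
  case 0
  have "card G / N - (0 + (\<Sum>t\<in>{0<..a}. real (a choose t) * (q / (q * \<Lambda>)) ^ t)) \<le> containment_prob (q * \<Lambda> + 0) E C G \<phi>"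
  proof (rule spread_round[where h=0 and N=N])
    show "card G' / N - 0 \<le> containment_prob 0 E C G' \<phi>'" if "spread E C N q 0 G' \<phi>'"
      for G' and \<phi>' :: "'s \<Rightarrow> ('e \<times> 'c) set"
      using containment_prob_empty[OF fin Nq(1) that] by simp
  qed (use 0 Nq L fin in auto)
  then show ?case using sum_choose_power_le[of "1 / \<Lambda>" a] Nq L by simp
next
  case (Suc r)
  let ?h = "a * 2 ^ r" and ?\<delta> = "(1 + 1 / \<Lambda>) ^ a - 1 + real r * (1 / 4) ^ a"
  have "card G / N - (?\<delta> + (\<Sum>t\<in>{?h<..2 * ?h}. real ((2 * ?h) choose t) * (q / (64 * q)) ^ t))
      \<le> containment_prob (64 * q + q * (\<Lambda> + 64 * real r)) E C G \<phi>"
  proof (rule spread_round[where h="?h" and N=N])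
    have "q * (\<Lambda> + 64 * real r) \<le> q * (\<Lambda> + 64 * real (Suc r))" using Nq by simp
    then have "real (card C) * (q * (\<Lambda> + 64 * real r)) \<le> real (card C) * (q * (\<Lambda> + 64 * real (Suc r)))"
      by (rule mult_left_mono) simp
    also have "\<dots> \<le> 1" using Suc.prems(1) .
    finally show "card G' / N - ?\<delta> \<le> containment_prob (q * (\<Lambda> + 64 * real r)) E C G' \<phi>'"
      if "spread E C N q ?h G' \<phi>'" for G' and \<phi>' :: "'s \<Rightarrow> ('e \<times> 'c) set"
      using that by (intro Suc.IH)
  qed (use Suc.prems Nq L fin in \<open>auto simp: algebra_simps\<close>)
  moreover have "(\<Sum>t\<in>{?h<..2 * ?h}. real ((2 * ?h) choose t) * (q / (64 * q)) ^ t) \<le> (1 / 4) ^ a"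
  proof -
    have "a \<le> 2 * ?h" by (simp add: trans_le_add1)
    then have "(1 / 4 :: real) ^ (2 * ?h) \<le> (1 / 4) ^ a" by (intro power_decreasing) auto
    then show ?thesis using order_trans[OF sum_choose_upper_half_le[of ?h]] Nq by simp
  qed
  moreover have "64 * q + q * (\<Lambda> + 64 * real r) = q * (\<Lambda> + 64 * real (Suc r))" by (simp add: algebra_simps)
  ultimately show ?case by (simp add: algebra_simps)
qed

section \<open>Rainbow perfect matchings are spread\<close>

text \<open>The edge of colour \<open>c\<close> in the matching coded by \<open>s\<close>. Indexing edges by colours rather than by
  their vertices in one of the parts treats all \<open>k\<close> parts alike.\<close>
definition color_edge :: "nat \<Rightarrow> (nat \<Rightarrow> nat \<Rightarrow> nat) \<Rightarrow> nat \<Rightarrow> vertex set" where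
  "color_edge k s c = (\<lambda>i. (i, s i c)) ` {..<k}"

definition matching_graph :: "nat \<Rightarrow> nat \<Rightarrow> (nat \<Rightarrow> nat \<Rightarrow> nat) \<Rightarrow> (vertex set \<times> nat) set" where
  "matching_graph k n s = (\<lambda>c. (color_edge k s c, c)) ` {..<n}"

definition perm_tuples :: "nat \<Rightarrow> nat \<Rightarrow> (nat \<Rightarrow> nat \<Rightarrow> nat) set" where
  "perm_tuples k n = {..<k} \<rightarrow>\<^sub>E {p. p permutes {..<n}}"

lemma perm_tuples_permutes: "s \<in> perm_tuples k n \<Longrightarrow> i < k \<Longrightarrow> s i permutes {..<n}"
  by (auto simp: perm_tuples_def)

lemma finite_perm_tuples: "finite (perm_tuples k n)"
  unfolding perm_tuples_def by (intro finite_PiE) (auto simp: finite_permutations)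

lemma card_perm_tuples: "card (perm_tuples k n) = fact n ^ k"
  unfolding perm_tuples_def by (subst card_PiE) (auto simp: card_permutations)

lemma color_edge_eqD: "color_edge k s c = color_edge k t d \<Longrightarrow> i < k \<Longrightarrow> s i c = t i d"
proof -
  assume eq: "color_edge k s c = color_edge k t d" and "i < k"
  then have "(i, s i c) \<in> color_edge k t d" unfolding eq[symmetric] by (auto simp: color_edge_def)
  then show "s i c = t i d" by (auto simp: color_edge_def)
qed

lemma color_edge_inter:
  assumes "s \<in> perm_tuples k n" "c < n" "i < k" 
  shows "color_edge k s c \<inter> part n i = {(i, s i c)}"
  using assms permutes_in_image[OF perm_tuples_permutes[OF assms(1,3)], of c]
  by (auto simp: color_edge_def part_def)

lemma color_edge_possible:
  assumes "s \<in> perm_tuples k n" "c < n"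
  shows "color_edge k s c \<in> possible_edges k n"
proof -
  have "(i, s i c) \<in> part n i" if "i < k" for i
    using color_edge_inter[OF assms that] by blast
  then have "color_edge k s c \<subseteq> vertices k n"
    by (auto simp: color_edge_def vertices_def)
  then show ?thesis using color_edge_inter[OF assms] by (simp add: possible_edges_def)
qed

lemma inj_on_color_edge:
  assumes "s \<in> perm_tuples k n" "0 < k"
  shows "color_edge k s c = color_edge k s d \<longleftrightarrow> c = d"
  using color_edge_eqD[of k s c s d 0] assms permutes_inj[OF perm_tuples_permutes[OF assms]]
  by (auto simp: inj_def)

lemma perfect_matching_color_edge:
  assumes "s \<in> perm_tuples k n"
  shows "perfect_matching k n (color_edge k s ` {..<n})"
proof -
  have "disjnt (color_edge k s c) (color_edge k s d)" if ne: "color_edge k s c \<noteq> color_edge k s d" for c d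
  proof -
    have "s i c \<noteq> s i d" if "i < k" for i
      using ne permutes_inj[OF perm_tuples_permutes[OF assms that]] by (auto simp: inj_def)
    then show ?thesis by (auto simp: disjnt_def color_edge_def)
  qed
  then have "pairwise disjnt (color_edge k s ` {..<n})" by (auto simp: pairwise_def)
  moreover have "\<Union> (color_edge k s ` {..<n}) = vertices k n"
  proof
    show "\<Union> (color_edge k s ` {..<n}) \<subseteq> vertices k n"
      using color_edge_possible[OF assms] by (auto simp: possible_edges_def)
    show "vertices k n \<subseteq> \<Union> (color_edge k s ` {..<n})"
    proof
      fix v assume "v \<in> vertices k n"
      then obtain i b where v: "v = (i, b)" "i < k" "b < n" by (auto simp: vertices_def part_def)
      then obtain c where "c < n" "b = s i c"
        using permutes_image[OF perm_tuples_permutes[OF assms v(2)]] by (metis imageE lessThan_iff)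
      then show "v \<in> \<Union> (color_edge k s ` {..<n})" using v by (auto simp: color_edge_def)
    qed
  qed
  ultimately show ?thesis
    using color_edge_possible[OF assms] by (auto simp: perfect_matching_def)
qed

lemma matching_graph_subset_graph_rainbow:
  assumes "s \<in> perm_tuples k n" "matching_graph k n s \<subseteq> Map.graph f"
  shows "has_rainbow_perfect_matching k n (dom f, \<lambda>e\<in>dom f. the (f e))"
proof -
  have f: "f (color_edge k s c) = Some c" if "c < n" for c
    using assms(2) that by (auto simp: matching_graph_def Map.graph_def)
  have "rainbow (\<lambda>e\<in>dom f. the (f e)) (color_edge k s ` {..<n})"
    using f by (auto simp: rainbow_def inj_on_def domIff)
  moreover have "color_edge k s ` {..<n} \<subseteq> dom f" using f by auto
  ultimately show ?thesis
    using perfect_matching_color_edge[OF assms(1)] by (auto simp: has_rainbow_perfect_matching_def)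
qed

text \<open>Dividing by one permutation \<open>p0\<close> with the prescribed values maps the others injectively to
  permutations that fix \<open>D\<close> pointwise.\<close>
lemma card_permutes_agree_le:
  assumes "finite S" "D \<subseteq> S"
  shows "card {p. p permutes S \<and> (\<forall>c\<in>D. p c = g c)} \<le> fact (card S - card D)"
proof (cases "{p. p permutes S \<and> (\<forall>c\<in>D. p c = g c)} = {}")
  case True
  show ?thesis unfolding True by simp
next
  case False
  then obtain p0 where p0: "p0 permutes S" "\<And>c. c \<in> D \<Longrightarrow> p0 c = g c" by auto
  let ?A = "{p. p permutes S \<and> (\<forall>c\<in>D. p c = g c)}"
  have "inj_on (\<lambda>p. inv p0 \<circ> p) ?A"
  proof (rule inj_onI)
    fix p p' assume "inv p0 \<circ> p = inv p0 \<circ> p'"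
    then have "p0 \<circ> (inv p0 \<circ> p) = p0 \<circ> (inv p0 \<circ> p')" by simp
    then show "p = p'" by (simp only: o_assoc permutes_inv_o(1)[OF p0(1)] id_o)
  qed
  moreover have "(\<lambda>p. inv p0 \<circ> p) ` ?A \<subseteq> {p. p permutes (S - D)}"
  proof clarify
    fix p assume p: "p permutes S" "\<forall>c\<in>D. p c = g c"
    have perm: "(inv p0 \<circ> p) permutes S"
      by (rule permutes_compose[OF p(1) permutes_inv[OF p0(1)]])
    have "(inv p0 \<circ> p) c = c" if "c \<in> D" for c
      using p0 p that permutes_inverses(2)[OF p0(1)] by (metis comp_apply)
    then show "(inv p0 \<circ> p) permutes (S - D)"
      using perm by (intro permutes_superset[OF perm]) auto
  qed
  moreover have "finite {p. p permutes (S - D)}" using assms by (simp add: finite_permutations)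
  ultimately have "card ?A \<le> card {p. p permutes (S - D)}" by (rule card_inj_on_le)
  also have "\<dots> = fact (card S - card D)"
    using assms by (intro card_permutations) (auto simp: card_Diff_subset finite_subset)
  finally show ?thesis .
qed

text \<open>The term of index \<open>t\<close> of the exponential series at \<open>t\<close> is at most its sum.\<close>
lemma fact_ge_power_div_exp: "(real t / exp 1) ^ t \<le> fact t"
proof -
  have "real t ^ t / fact t \<le> exp (real t)"
  proof -
    have "(\<Sum>i\<in>{t}. inverse (fact i) * real t ^ i) \<le> exp (real t)"
      unfolding exp_def real_scaleR_def
      by (intro sum_le_suminf) (use summable_exp[of "real t"] in \<open>auto simp: mult_ac\<close>)
    then show ?thesis by (simp add: field_simps)
  qed
  also have "exp (real t) = exp 1 ^ t" by (simp add: exp_of_nat_mult[symmetric])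
  finally show ?thesis by (simp add: power_divide field_simps)
qed

text \<open>Combine \<open>n! = (n choose t) t! (n - t)!\<close> with \<open>(n / t)\<^sup>t \<le> (n choose t)\<close> and
  \<open>(t / e)\<^sup>t \<le> t!\<close>.\<close>
lemma fact_diff_le:
  assumes "t \<le> n" "0 < n"
  shows "fact (n - t) \<le> fact n * (exp 1 / real n) ^ t"
proof (cases "t = 0")
  case False
  have "(real n / exp 1) ^ t = (real n / real t) ^ t * (real t / exp 1) ^ t"
    using False by (simp flip: power_mult_distrib)
  also have "\<dots> \<le> real (n choose t) * fact t"
    using assms by (intro mult_mono binomial_ge_n_over_k_pow_k fact_ge_power_div_exp) auto
  finally have "(real n / exp 1) ^ t * fact (n - t) \<le> real (n choose t) * fact t * fact (n - t)"
    by (rule mult_right_mono) simp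
  also have "\<dots> = fact n"
    using arg_cong[OF binomial_fact_lemma[OF assms(1)], of real] by (simp add: mult_ac)
  finally show ?thesis using assms by (simp add: power_divide field_simps)
qed simp

text \<open>A pair (edge, colour) prescribes the values of all \<open>k\<close> permutations at that colour, and the
  pairs of a matching have distinct colours. So \<open>t\<close> pairs fix each permutation at \<open>t\<close> points.\<close>
lemma spread_matchings:
  assumes "0 < k" "0 < n"
  shows "spread (possible_edges k n) {..<n} (fact n ^ k) ((exp 1 / real n) ^ k) n
           (perm_tuples k n) (matching_graph k n)"
  unfolding spread_def
proof (intro conjI ballI allI finite_perm_tuples)
  fix s assume s: "s \<in> perm_tuples k n"
  show "matching_graph k n s \<subseteq> possible_edges k n \<times> {..<n}"
    using color_edge_possible[OF s] by (auto simp: matching_graph_def)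
  show "single_valued (matching_graph k n s)"
    using inj_on_color_edge[OF s assms(1)] by (auto simp: single_valued_def matching_graph_def)
  show "card (matching_graph k n s) \<le> n"
    using card_image_le[of "{..<n}" "\<lambda>c. (color_edge k s c, c)"] by (simp add: matching_graph_def)
next
  fix A :: "(vertex set \<times> nat) set"
  let ?G = "{s \<in> perm_tuples k n. A \<subseteq> matching_graph k n s}"
  show "real (card ?G) \<le> fact n ^ k * ((exp 1 / real n) ^ k) ^ card A"
  proof (cases "?G = {}")
    case True
    show ?thesis unfolding True by simp
  next
    case False
    then obtain s0 where s0: "s0 \<in> perm_tuples k n" "A \<subseteq> matching_graph k n s0" by auto
    define D where "D = snd ` A"
    have D: "D \<subseteq> {..<n}" using s0 by (auto simp: D_def matching_graph_def)
    have "inj_on snd (matching_graph k n s0)" by (auto simp: inj_on_def matching_graph_def)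
    then have "inj_on snd A" using s0(2) by (rule inj_on_subset)
    then have cD: "card D = card A" by (simp add: D_def card_image)
    have "card D \<le> card {..<n}" using D by (intro card_mono) auto
    then have le: "card A \<le> n" using cD by simp
    have "?G \<subseteq> PiE {..<k} (\<lambda>i. {p. p permutes {..<n} \<and> (\<forall>c\<in>D. p c = s0 i c)})"
    proof
      fix s assume s: "s \<in> ?G"
      have "s i c = s0 i c" if i: "i < k" and c: "c \<in> D" for i c
      proof -
        obtain e where "(e, c) \<in> A" using c by (auto simp: D_def)
        then have "(e, c) \<in> matching_graph k n s" "(e, c) \<in> matching_graph k n s0" using s s0(2) by blast+
        then have "e = color_edge k s c" "e = color_edge k s0 c" by (auto simp: matching_graph_def)
        then have "color_edge k s c = color_edge k s0 c" by simp
        then show ?thesis by (rule color_edge_eqD[OF _ i])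
      qed
      then have "s i \<in> {p. p permutes {..<n} \<and> (\<forall>c\<in>D. p c = s0 i c)}" if "i < k" for i
        using s perm_tuples_permutes[of s k n i] that by simp
      moreover have "s \<in> extensional {..<k}" using s by (simp add: perm_tuples_def PiE_def)
      ultimately show "s \<in> PiE {..<k} (\<lambda>i. {p. p permutes {..<n} \<and> (\<forall>c\<in>D. p c = s0 i c)})"
        by (simp add: PiE_def)
    qed
    moreover have "finite {p. p permutes {..<n} \<and> (\<forall>c\<in>D. p c = s0 i c)}" for i
      by (rule finite_subset[OF _ finite_permutations[of "{..<n}"]]) auto
    ultimately have "card ?G \<le> card (PiE {..<k} (\<lambda>i. {p. p permutes {..<n} \<and> (\<forall>c\<in>D. p c = s0 i c)}))"
      by (intro card_mono finite_PiE) simp_all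
    also have "\<dots> = (\<Prod>i<k. card {p. p permutes {..<n} \<and> (\<forall>c\<in>D. p c = s0 i c)})"
      by (simp add: card_PiE)
    also have "\<dots> \<le> (\<Prod>i<k. fact (n - card A))"
      using card_permutes_agree_le[OF finite_lessThan D] cD by (intro prod_mono) simp
    also have "\<dots> = fact (n - card A) ^ k" by simp
    finally have "real (card ?G) \<le> real (fact (n - card A) ^ k)" by (rule of_nat_mono)
    also have "\<dots> = fact (n - card A) ^ k" by simp
    also have "\<dots> \<le> (fact n * (exp 1 / real n) ^ card A) ^ k"
      using le assms by (intro power_mono fact_diff_le) auto
    also have "\<dots> = fact n ^ k * ((exp 1 / real n) ^ k) ^ card A"
      by (simp only: power_mult_distrib power_mult[symmetric] mult.commute)
    finally show ?thesis .
  qed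
qed

lemma card_possible_edges: "card (possible_edges k n) = n ^ k" "finite (possible_edges k n)"
proof -
  let ?g = "\<lambda>v::nat\<Rightarrow>nat. (\<lambda>i. (i, v i)) ` {..<k}"
  have "bij_betw ?g ({..<k} \<rightarrow>\<^sub>E {..<n}) (possible_edges k n)"
    unfolding bij_betw_def
  proof
    show "inj_on ?g ({..<k} \<rightarrow>\<^sub>E {..<n})"
    proof (rule inj_onI)
      fix v w assume v: "v \<in> {..<k} \<rightarrow>\<^sub>E {..<n}" "w \<in> {..<k} \<rightarrow>\<^sub>E {..<n}" and eq: "?g v = ?g w"
      have "v i = w i" if "i < k" for i
      proof -
        have "(i, v i) \<in> ?g w" unfolding eq[symmetric] using that by auto
        then show ?thesis by auto
      qed
      then show "v = w" by (intro PiE_ext[OF v]) auto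
    qed
    show "?g ` ({..<k} \<rightarrow>\<^sub>E {..<n}) = possible_edges k n"
    proof (intro equalityI subsetI)
      fix e assume "e \<in> ?g ` ({..<k} \<rightarrow>\<^sub>E {..<n})"
      then obtain v where v: "v \<in> {..<k} \<rightarrow>\<^sub>E {..<n}" "e = ?g v" by auto
      have vn: "v i < n" if "i < k" for i using v(1) that by auto
      have "e \<inter> part n i = {(i, v i)}" if "i < k" for i
        unfolding v(2) part_def using vn[OF that] that by auto
      moreover have "e \<subseteq> vertices k n"
        unfolding v(2) vertices_def part_def using vn by auto
      ultimately show "e \<in> possible_edges k n" by (simp add: possible_edges_def)
    next
      fix e assume e: "e \<in> possible_edges k n"
      have "\<forall>i<k. \<exists>b. e \<inter> part n i = {(i, b)}"
      proof (intro allI impI)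
        fix i assume "i < k"
        then have "card (e \<inter> part n i) = 1" using e by (auto simp: possible_edges_def)
        then obtain v where v: "e \<inter> part n i = {v}" by (rule card_1_singletonE)
        then have "v \<in> part n i" by blast
        then have "v = (i, snd v)" by (auto simp: part_def)
        with v show "\<exists>b. e \<inter> part n i = {(i, b)}" by metis
      qed
      then have "\<exists>b. \<forall>i<k. e \<inter> part n i = {(i, b i)}" by (rule choice_iff'[THEN iffD1])
      then obtain b where b: "\<And>i. i < k \<Longrightarrow> e \<inter> part n i = {(i, b i)}" by blast
      have "e = ?g (restrict b {..<k})"
      proof (intro equalityI subsetI)
        fix v assume v: "v \<in> e"
        then obtain i where "i < k" "v \<in> part n i" using e by (auto simp: possible_edges_def vertices_def)
        then have "v \<in> {(i, b i)}" using v b by blast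
        then show "v \<in> ?g (restrict b {..<k})" using \<open>i < k\<close> by auto
      next
        fix v assume "v \<in> ?g (restrict b {..<k})"
        then obtain i where "i < k" "v = (i, b i)" by auto
        then show "v \<in> e" using b by blast
      qed
      moreover have "b i < n" if "i < k" for i
      proof -
        have "(i, b i) \<in> part n i" using b[OF that] by blast
        then show ?thesis by (simp add: part_def)
      qed
      then have "restrict b {..<k} \<in> {..<k} \<rightarrow>\<^sub>E {..<n}" by auto
      ultimately show "e \<in> ?g ` ({..<k} \<rightarrow>\<^sub>E {..<n})" by (rule image_eqI)
    qed
  qed
  note bij = this
  show "card (possible_edges k n) = n ^ k"
    using bij_betw_same_card[OF bij] by (simp add: card_PiE)
  have "finite ({..<k} \<rightarrow>\<^sub>E {..<n})" by (intro finite_PiE) auto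
  then show "finite (possible_edges k n)" using bij_betw_finite[OF bij] by blast
qed

section \<open>From independent edges to a fixed number of edges\<close>

definition level :: "'e set \<Rightarrow> 'c set \<Rightarrow> nat \<Rightarrow> ('e \<rightharpoonup> 'c) set" where
  "level E C j = {f \<in> partial_colorings E C. card (dom f) = j}"

lemma finite_level: "finite E \<Longrightarrow> finite C \<Longrightarrow> finite (level E C j)"
  by (auto simp: level_def finite_partial_colorings)

text \<open>The partial colourings with \<open>j\<close> coloured elements are the coloured hypergraphs with \<open>j\<close> edges.\<close>
lemma bij_betw_level:
  "bij_betw (\<lambda>f. (dom f, \<lambda>e\<in>dom f. the (f e))) (level E C j)
     (SIGMA D:{D. D \<subseteq> E \<and> card D = j}. D \<rightarrow>\<^sub>E C)"
proof (rule bij_betw_byWitness[where f' = "\<lambda>(D, c) e. if e \<in> D then Some (c e) else None"])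
  show "\<forall>f\<in>level E C j. (\<lambda>(D, c) e. if e \<in> D then Some (c e) else None)
      (dom f, \<lambda>e\<in>dom f. the (f e)) = f"
    by (auto simp: fun_eq_iff domIff)
  show "\<forall>p\<in>SIGMA D:{D. D \<subseteq> E \<and> card D = j}. D \<rightarrow>\<^sub>E C.
      (\<lambda>f. (dom f, \<lambda>e\<in>dom f. the (f e))) ((\<lambda>(D, c) e. if e \<in> D then Some (c e) else None) p) = p"
    by (auto simp: fun_eq_iff dom_def PiE_iff extensional_def)
  show "(\<lambda>f. (dom f, \<lambda>e\<in>dom f. the (f e))) ` level E C j
      \<subseteq> (SIGMA D:{D. D \<subseteq> E \<and> card D = j}. D \<rightarrow>\<^sub>E C)"
  proof (rule image_subsetI)
    fix f assume f: "f \<in> level E C j"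
    have "the (f e) \<in> C" if "e \<in> dom f" for e
      using f that by (auto simp: level_def partial_colorings_def intro: ranI)
    then have "(\<lambda>e\<in>dom f. the (f e)) \<in> dom f \<rightarrow>\<^sub>E C" by (rule restrict_PiE_iff[THEN iffD2, rule_format])
    then show "(dom f, \<lambda>e\<in>dom f. the (f e)) \<in> (SIGMA D:{D. D \<subseteq> E \<and> card D = j}. D \<rightarrow>\<^sub>E C)"
      using f by (simp add: level_def partial_colorings_def)
  qed
  show "(\<lambda>(D, c) e. if e \<in> D then Some (c e) else None) ` (SIGMA D:{D. D \<subseteq> E \<and> card D = j}. D \<rightarrow>\<^sub>E C)
      \<subseteq> level E C j"
    by (auto simp: level_def partial_colorings_def ran_def dom_def split: if_splits)
qed

lemma card_level:
  assumes "finite E" "finite C"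
  shows "card (level E C j) = (card E choose j) * card C ^ j"
proof -
  have fin: "finite D" if "D \<subseteq> E" for D using that assms(1) by (rule finite_subset)
  have "card (level E C j) = (\<Sum>D\<in>{D. D \<subseteq> E \<and> card D = j}. card (D \<rightarrow>\<^sub>E C))"
    using assms fin by (subst bij_betw_same_card[OF bij_betw_level], subst card_SigmaI)
      (auto intro: finite_PiE)
  also have "\<dots> = (\<Sum>D\<in>{D. D \<subseteq> E \<and> card D = j}. card C ^ j)"
    using fin by (intro sum.cong) (auto simp: card_PiE)
  finally show ?thesis using assms by (simp add: n_subsets)
qed

text \<open>Double counting: every colouring of \<open>j\<close> elements extends in \<open>(card E - j) card C\<close> ways to one of
  \<open>j + 1\<close> elements, and each of the latter arises from at most \<open>j + 1\<close> of the former. Without the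
  restriction to \<open>Q\<close> both counts are exact.\<close>
lemma level_mono_Suc:
  assumes fin: "finite E" "finite C" "C \<noteq> {}" and j: "j < card E"
    and up: "\<And>f g. f \<in> partial_colorings E C \<Longrightarrow> g \<in> partial_colorings E C \<Longrightarrow> f \<subseteq>\<^sub>m g \<Longrightarrow> Q f \<Longrightarrow> Q g"
  shows "card {f \<in> level E C j. Q f} / card (level E C j)
       \<le> card {f \<in> level E C (Suc j). Q f} / card (level E C (Suc j))"
proof -
  let ?a = "card {f \<in> level E C j. Q f}" and ?b = "card {f \<in> level E C (Suc j). Q f}"
  let ?n = "card C" and ?M = "card E"
  let ?P = "SIGMA f:{f \<in> level E C j. Q f}. (E - dom f) \<times> C"
  let ?R = "SIGMA g:{g \<in> level E C (Suc j). Q g}. dom g"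
  let ?u = "\<lambda>(f, e, c). (f(e \<mapsto> c), e)"
  have finf: "finite (dom f)" "dom f \<subseteq> E" if "f \<in> level E C i" for f i
    using that fin by (auto simp: level_def partial_colorings_def intro: finite_subset)
  have "card ?P = (\<Sum>f\<in>{f \<in> level E C j. Q f}. card ((E - dom f) \<times> C))"
    using fin by (intro card_SigmaI) (auto simp: finite_level)
  also have "\<dots> = (\<Sum>f\<in>{f \<in> level E C j. Q f}. (?M - j) * ?n)"
    using finf by (intro sum.cong refl) (auto simp: card_cartesian_product card_Diff_subset level_def)
  finally have P: "card ?P = ?a * ((?M - j) * ?n)" by simp
  have "card ?R = (\<Sum>g\<in>{g \<in> level E C (Suc j). Q g}. card (dom g))"
    using fin finf by (intro card_SigmaI) (auto simp: finite_level)
  also have "\<dots> = (\<Sum>g\<in>{g \<in> level E C (Suc j). Q g}. Suc j)"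
    by (intro sum.cong) (auto simp: level_def)
  finally have R: "card ?R = ?b * Suc j" by simp
  have "inj_on ?u ?P"
  proof (rule inj_onI)
    fix p p' assume p: "p \<in> ?P" "p' \<in> ?P" and eq: "?u p = ?u p'"
    obtain f e c f' e' c' where [simp]: "p = (f, e, c)" "p' = (f', e', c')" by (metis prod.exhaust)
    have [simp]: "e' = e" and eq': "f(e \<mapsto> c) = f'(e \<mapsto> c')" using eq by auto
    have "f e = None" "f' e = None" using p by auto
    moreover have "f y = f' y" if "y \<noteq> e" for y using fun_cong[OF eq', of y] that by simp
    ultimately have "f = f'" by (metis ext)
    moreover have "c = c'" using fun_cong[OF eq', of e] by simp
    ultimately show "p = p'" by simp
  qed
  moreover have "?u ` ?P \<subseteq> ?R"
  proof (rule image_subsetI)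
    fix p assume "p \<in> ?P"
    then obtain f e c where p: "p = (f, e, c)" and f: "f \<in> level E C j" "Q f"
      and e: "e \<in> E" "e \<notin> dom f" "c \<in> C" by auto
    have ran: "ran (f(e \<mapsto> c)) \<subseteq> insert c (ran f)" by (auto simp: ran_def)
    have g: "f(e \<mapsto> c) \<in> partial_colorings E C"
      using f e ran by (auto simp: level_def partial_colorings_def)
    moreover have "card (dom (f(e \<mapsto> c))) = Suc j"
      using f e finf[OF f(1)] by (simp add: level_def)
    moreover have "Q (f(e \<mapsto> c))"
      using f e by (intro up[OF _ g]) (auto simp: level_def map_le_def)
    ultimately show "?u p \<in> ?R"
      by (simp add: level_def p)
  qed
  moreover have "finite ?R" using fin finf by (intro finite_SigmaI) (auto simp: finite_level)
  ultimately have "card ?P \<le> card ?R" by (rule card_inj_on_le)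
  then have le: "?a * ((?M - j) * ?n) \<le> ?b * Suc j" unfolding P R .
  have tot: "card (level E C j) * ((?M - j) * ?n) = card (level E C (Suc j)) * Suc j"
  proof -
    have "(?M choose j) * (?M - j) = (?M choose Suc j) * Suc j"
      using binomial_absorb_comp[of ?M j] binomial_absorption[of j ?M] by (simp only: mult.commute)
    then have "(?M choose j) * (?M - j) * (?n ^ j * ?n) = (?M choose Suc j) * Suc j * (?n ^ j * ?n)"
      by (rule arg_cong)
    then show ?thesis by (simp only: card_level[OF fin(1,2)] power_Suc mult_ac)
  qed
  have n: "0 < ?n" "0 < ?M - j" using fin j by (auto simp: card_gt_0_iff)
  let ?w = "real ((?M - j) * ?n)"
  have pos: "0 < card (level E C j)" "0 < card (level E C (Suc j))"
    using n j by (simp_all add: card_level[OF fin(1,2)])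
  have "real ?a / card (level E C j) = real (?a * ((?M - j) * ?n)) / (card (level E C j) * ((?M - j) * ?n))"
    using n by simp
  also have "\<dots> \<le> real (?b * Suc j) / (card (level E C (Suc j)) * Suc j)"
    unfolding tot by (intro divide_right_mono) (use le in \<open>simp_all only: of_nat_le_iff of_nat_0_le_iff\<close>)
  also have "\<dots> = real ?b / card (level E C (Suc j))"
    by (simp only: of_nat_mult) (rule mult_divide_mult_cancel_right, simp)
  finally show ?thesis .
qed

lemma level_mono:
  assumes fin: "finite E" "finite C" "C \<noteq> {}" and j: "j \<le> m" "m \<le> card E"
    and up: "\<And>f g. f \<in> partial_colorings E C \<Longrightarrow> g \<in> partial_colorings E C \<Longrightarrow> f \<subseteq>\<^sub>m g \<Longrightarrow> Q f \<Longrightarrow> Q g"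
  shows "card {f \<in> level E C j. Q f} / card (level E C j)
       \<le> card {f \<in> level E C m. Q f} / card (level E C m)"
  using j
proof (induction m rule: dec_induct)
  case base
  then show ?case by simp
next
  case (step i)
  then have "card {f \<in> level E C j. Q f} / card (level E C j)
    \<le> card {f \<in> level E C i. Q f} / card (level E C i)" by simp
  also have "\<dots> \<le> card {f \<in> level E C (Suc i). Q f} / card (level E C (Suc i))"
    using step by (intro level_mono_Suc[OF fin _ up]) auto
  finally show ?case .
qed

text \<open>Split according to the number \<open>j\<close> of coloured elements, which is binomially distributed. For
  \<open>j \<le> m\<close> the conditional probability of \<open>Q\<close> is at most that at \<open>m\<close>. The probability that \<open>j > m\<close> is
  bounded by Markov's inequality for \<open>2\<^sup>j\<close>, whose mean is \<open>(1 + p)\<^bsup>card E\<^esup> \<le> e\<^bsup>m / 2\<^esup>\<close> for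
  \<open>p = card C * x\<close>.\<close>
lemma avg_le_level:
  fixes x :: real
  assumes fin: "finite E" "finite C" "C \<noteq> {}" and m: "m \<le> card E"
    and x: "0 \<le> x" "card C * x \<le> 1" "card E * (card C * x) \<le> m / 2"
    and up: "\<And>f g. f \<in> partial_colorings E C \<Longrightarrow> g \<in> partial_colorings E C \<Longrightarrow> f \<subseteq>\<^sub>m g \<Longrightarrow> Q f \<Longrightarrow> Q g"
  shows "avg x E C (\<lambda>f. of_bool (Q f))
       \<le> card {f \<in> level E C m. Q f} / card (level E C m) + (exp (1 / 2) / 2) ^ m"
proof -
  let ?M = "card E"
  define p where "p = card C * x"
  define cnt where "cnt j = real (card {f \<in> level E C j. Q f})" for j
  define b where "b j = real (?M choose j) * p ^ j * (1 - p) ^ (?M - j)" for j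
  let ?rm = "cnt m / card (level E C m)"
  have rm: "0 \<le> ?rm" by (simp add: cnt_def)
  have p: "0 \<le> p" "0 \<le> 1 - p" using x by (auto simp: p_def)
  have b0: "0 \<le> b j" for j using p by (simp add: b_def)
  have cl: "card (dom f) \<le> ?M" "card (E - dom f) = ?M - card (dom f)" if "f \<in> partial_colorings E C" for f
  proof -
    have d: "dom f \<subseteq> E" using that by (simp add: partial_colorings_def)
    then show "card (dom f) \<le> ?M" using fin by (intro card_mono)
    show "card (E - dom f) = ?M - card (dom f)"
      using d finite_subset[OF d fin(1)] by (intro card_Diff_subset)
  qed
  have "avg x E C (\<lambda>f. of_bool (Q f)) = (\<Sum>f\<in>partial_colorings E C. \<Sum>j\<le>?M. if card (dom f) = j then mass x E C f * of_bool (Q f) else 0)"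
    unfolding avg_def using cl by (intro sum.cong) auto
  also have "\<dots> = (\<Sum>j\<le>?M. \<Sum>f\<in>partial_colorings E C. if card (dom f) = j then mass x E C f * of_bool (Q f) else 0)"
    by (rule sum.swap)
  also have "\<dots> = (\<Sum>j\<le>?M. cnt j * (x ^ j * (1 - p) ^ (?M - j)))"
  proof (intro sum.cong refl)
    fix j
    have "(\<Sum>f\<in>partial_colorings E C. if card (dom f) = j then mass x E C f * of_bool (Q f) else 0)
      = (\<Sum>f\<in>{f \<in> level E C j. Q f}. mass x E C f)"
      using finite_partial_colorings[OF fin(1,2)] by (intro sum.mono_neutral_cong_right) (auto simp: level_def)
    also have "\<dots> = (\<Sum>f\<in>{f \<in> level E C j. Q f}. x ^ j * (1 - p) ^ (?M - j))"
      using cl by (intro sum.cong) (auto simp: level_def mass_def p_def)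
    finally show "(\<Sum>f\<in>partial_colorings E C. if card (dom f) = j then mass x E C f * of_bool (Q f) else 0)
      = cnt j * (x ^ j * (1 - p) ^ (?M - j))" by (simp add: cnt_def)
  qed
  also have "\<dots> = (\<Sum>j\<le>?M. cnt j / card (level E C j) * b j)"
  proof (intro sum.cong refl)
    fix j assume "j \<in> {..?M}"
    then have "0 < (?M choose j) * card C ^ j" using fin by (simp add: card_gt_0_iff)
    then show "cnt j * (x ^ j * (1 - p) ^ (?M - j)) = cnt j / card (level E C j) * b j"
      using fin by (simp add: card_level b_def p_def power_mult_distrib)
  qed
  also have "\<dots> \<le> (\<Sum>j\<le>?M. ?rm * b j + (1 / 2) ^ m * (2 ^ j * b j))"
  proof (intro sum_mono)
    fix j assume j: "j \<in> {..?M}"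
    show "cnt j / card (level E C j) * b j \<le> ?rm * b j + (1 / 2) ^ m * (2 ^ j * b j)"
    proof (cases "j \<le> m")
      case True
      then have "cnt j / card (level E C j) * b j \<le> ?rm * b j"
        unfolding cnt_def using b0 by (intro mult_right_mono level_mono[OF fin _ m up]) auto
      then show ?thesis using b0[of j] by (simp add: add_increasing2)
    next
      case False
      have "cnt j \<le> card (level E C j)"
        unfolding cnt_def using fin by (intro of_nat_mono card_mono) (auto simp: finite_level)
      then have "cnt j / card (level E C j) * b j \<le> 1 * b j"
        using b0 by (intro mult_right_mono) (auto simp: divide_le_eq_1 cnt_def)
      also have "\<dots> \<le> ((1 / 2) ^ m * 2 ^ j) * b j"
      proof (intro mult_right_mono b0)
        have "(2 :: real) ^ m \<le> 2 ^ j" using False by (intro power_increasing) auto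
        then show "(1 :: real) \<le> (1 / 2) ^ m * 2 ^ j" by (simp add: power_divide)
      qed
      finally show ?thesis using mult_nonneg_nonneg[OF rm b0[of j]] by (simp add: mult.assoc)
    qed
  qed
  also have "\<dots> = ?rm * (\<Sum>j\<le>?M. b j) + (1 / 2) ^ m * (\<Sum>j\<le>?M. 2 ^ j * b j)"
    by (simp add: sum.distrib sum_distrib_left)
  also have "(\<Sum>j\<le>?M. b j) = 1"
    unfolding b_def using binomial_ring[of p "1 - p" ?M] by simp
  also have "?rm * 1 + (1 / 2) ^ m * (\<Sum>j\<le>?M. 2 ^ j * b j) \<le> ?rm * 1 + (1 / 2) ^ m * exp (1 / 2) ^ m"
  proof (intro add_left_mono mult_left_mono)
    have "(\<Sum>j\<le>?M. 2 ^ j * b j) = (2 * p + (1 - p)) ^ ?M"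
      unfolding b_def binomial_ring by (intro sum.cong refl) (simp only: power_mult_distrib mult_ac)
    also have "\<dots> \<le> exp p ^ ?M"
      using p exp_ge_add_one_self[of p] by (intro power_mono) (auto simp: algebra_simps)
    also have "\<dots> = exp (?M * p)" by (rule exp_of_nat_mult[symmetric])
    also have "\<dots> \<le> exp (m * (1 / 2))" using x(3) by (simp add: p_def)
    also have "\<dots> = exp (1 / 2) ^ m" by (rule exp_of_nat_mult)
    finally show "(\<Sum>j\<le>?M. 2 ^ j * b j) \<le> exp (1 / 2) ^ m" .
  qed simp
  finally show ?thesis by (simp add: cnt_def power_divide)
qed

lemma prob_HP_eq:
  assumes "0 < n" "m \<le> n ^ k"
  shows "measure_pmf.prob (HP n n m k) {H. has_rainbow_perfect_matching k n H}
    = card {f \<in> level (possible_edges k n) {..<n} m.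
         has_rainbow_perfect_matching k n (dom f, \<lambda>e\<in>dom f. the (f e))}
      / card (level (possible_edges k n) {..<n} m)"
proof -
  let ?L = "level (possible_edges k n) {..<n} m" and ?h = "has_rainbow_perfect_matching k n"
  let ?u = "\<lambda>f. (dom f, \<lambda>e\<in>dom f. the (f e :: nat option))"
  have bij: "bij_betw ?u ?L (colored_hypergraphs n n m k)"
    unfolding colored_hypergraphs_def by (rule bij_betw_level)
  have L: "finite ?L" "0 < card ?L"
    using assms by (auto simp: finite_level card_possible_edges card_level)
  then have S: "finite (colored_hypergraphs n n m k)" "colored_hypergraphs n n m k \<noteq> {}"
    using bij bij_betw_finite[OF bij] by (auto simp: bij_betw_def)
  have "colored_hypergraphs n n m k \<inter> {H. ?h H} = ?u ` {f \<in> ?L. ?h (?u f)}"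
    unfolding bij_betw_imp_surj_on[OF bij, symmetric] by blast
  moreover have "inj_on ?u {f \<in> ?L. ?h (?u f)}"
    using bij by (auto simp: bij_betw_def intro: inj_on_subset)
  ultimately have "card (colored_hypergraphs n n m k \<inter> {H. ?h H}) = card {f \<in> ?L. ?h (?u f)}"
    by (simp add: card_image)
  then show ?thesis
    using S bij_betw_same_card[OF bij] by (simp add: HP_def measure_pmf_of_set)
qed

section \<open>Almost sure existence\<close>

lemma prob_HP_lower_bound:
  assumes n: "0 < n" and k: "0 < k" and m: "m \<le> n ^ k" and r: "n \<le> a * 2 ^ r" and L: "0 < \<Lambda>"
    and dens: "real n * (exp 1 ^ k * (\<Lambda> + 64 * real r)) \<le> m / 2"
  shows "1 - ((1 + 1 / \<Lambda>) ^ a - 1 + real r * (1 / 4) ^ a) - (exp (1 / 2) / 2) ^ m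
     \<le> measure_pmf.prob (HP n n m k) {H. has_rainbow_perfect_matching k n H}"
proof -
  define q where "q = (exp 1 / real n) ^ k"
  define x where "x = q * (\<Lambda> + 64 * real r)"
  let ?E = "possible_edges k n" and ?C = "{..<n}"
  have q: "0 < q" using n by (simp add: q_def)
  have x0: "0 \<le> x" using q L by (simp add: x_def)
  have edges: "real (n ^ k) * (real n * x) \<le> m / 2"
    using dens n by (simp add: x_def q_def power_divide mult_ac)
  also have "\<dots> \<le> real (n ^ k) * 1"
  proof -
    have "real m \<le> real (n ^ k)" using m by (simp only: of_nat_le_iff)
    then show ?thesis by linarith
  qed
  finally have nx: "real n * x \<le> 1" using n by (simp only: mult_le_cancel_left_pos of_nat_0_less_iff zero_less_power)
  have "spread ?E ?C (fact n ^ k) q (a * 2 ^ r) (perm_tuples k n) (matching_graph k n)"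
    using spread_matchings[OF k n] r unfolding spread_def q_def by (meson order_trans)
  then have "card (perm_tuples k n) / fact n ^ k - ((1 + 1 / \<Lambda>) ^ a - 1 + real r * (1 / 4) ^ a)
      \<le> containment_prob x ?E ?C (perm_tuples k n) (matching_graph k n)"
    unfolding x_def using q L nx by (intro spread_threshold) (auto simp: card_possible_edges x_def)
  also have "containment_prob x ?E ?C (perm_tuples k n) (matching_graph k n)
     \<le> card {f \<in> level ?E ?C m. \<exists>s\<in>perm_tuples k n. matching_graph k n s \<subseteq> Map.graph f} / card (level ?E ?C m)
       + (exp (1 / 2) / 2) ^ m"
    unfolding containment_prob_def
  proof (rule avg_le_level)
    show "\<exists>s\<in>perm_tuples k n. matching_graph k n s \<subseteq> Map.graph g"
      if "f \<subseteq>\<^sub>m g" "\<exists>s\<in>perm_tuples k n. matching_graph k n s \<subseteq> Map.graph f" for f g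
    proof -
      have "Map.graph f \<subseteq> Map.graph g" using that(1) by (force simp: Map.graph_def map_le_def dom_def)
      then show ?thesis using that(2) by blast
    qed
  qed (use n m x0 nx edges in \<open>auto simp: card_possible_edges\<close>)
  also have "card {f \<in> level ?E ?C m. \<exists>s\<in>perm_tuples k n. matching_graph k n s \<subseteq> Map.graph f} / card (level ?E ?C m)
     \<le> measure_pmf.prob (HP n n m k) {H. has_rainbow_perfect_matching k n H}"
    unfolding prob_HP_eq[OF n m]
    by (intro divide_right_mono of_nat_mono card_mono)
      (auto simp: finite_level card_possible_edges intro: matching_graph_subset_graph_rainbow)
  finally show ?thesis by (simp add: card_perm_tuples)
qed

theorem theorem1p1:
  fixes k :: nat
  assumes "k \<ge> 2"
  shows "\<exists>K::real. \<forall>m :: nat \<Rightarrow> nat.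
           (\<forall>\<^sub>F n in sequentially. K * real n * ln (real n) \<le> real (m n) \<and> m n \<le> n ^ k) \<longrightarrow>
           (\<lambda>n. measure_pmf.prob (HP n n (m n) k) {H. has_rainbow_perfect_matching k n H})
             \<longlonglongrightarrow> 1"
proof (intro exI allI impI)
  fix m :: "nat \<Rightarrow> nat"
  assume ev: "\<forall>\<^sub>F n in sequentially. (322 * exp 1 ^ k) * real n * ln (real n) \<le> real (m n) \<and> m n \<le> n ^ k"
  let ?P = "\<lambda>n. measure_pmf.prob (HP n n (m n) k) {H. has_rainbow_perfect_matching k n H}"
  \<comment> \<open>The errors for \<open>\<Lambda> = log n\<close>, about \<open>sqrt (log n)\<close> for \<open>a\<close> and about \<open>log\<^sub>2 n\<close> for \<open>r\<close>. The density
    \<open>q (\<Lambda> + 64 r)\<close> is then at most \<open>161 q log n\<close>, and \<open>322\<close> leaves the factor \<open>2\<close> that keeps the mean number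
    of edges below \<open>m / 2\<close>.\<close>
  define \<epsilon> :: "nat \<Rightarrow> real" where
    "\<epsilon> n = exp ((sqrt (ln n) + 1) / ln n) - 1 + (log 2 n + 1) * (1 / 4) powr sqrt (ln n)
      + (exp (1 / 2) / 2) ^ n" for n
  have e2: "exp (1 / 2 :: real) / 2 < 1"
  proof -
    have "exp (1 / 2 :: real) ^ 2 = exp 1" by (simp flip: exp_of_nat_mult)
    also have "\<dots> < 2 ^ 2" using exp_le by simp
    finally show ?thesis using power_less_imp_less_base[of "exp (1 / 2 :: real)" 2 2] by simp
  qed
  have "\<epsilon> \<longlonglongrightarrow> 0 + 0"
    unfolding \<epsilon>_def
  proof (intro tendsto_add)
    show "(\<lambda>n. exp ((sqrt (ln (real n)) + 1) / ln (real n)) - 1 + (log 2 (real n) + 1) * (1 / 4) powr sqrt (ln (real n))) \<longlonglongrightarrow> 0"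
      by real_asymp
    show "(\<lambda>n. (exp (1 / 2) / 2 :: real) ^ n) \<longlonglongrightarrow> 0"
      using e2 by (intro LIMSEQ_realpow_zero) auto
  qed
  then have lim: "(\<lambda>n. 1 - \<epsilon> n) \<longlonglongrightarrow> 1" by (auto intro: tendsto_eq_intros)
  have "\<forall>\<^sub>F n in sequentially. 1 \<le> ln (real n)" by real_asymp
  then have "\<forall>\<^sub>F n in sequentially. 1 - \<epsilon> n \<le> ?P n"
    using ev
  proof eventually_elim
    case (elim n)
    define \<Lambda> where "\<Lambda> = ln (real n)"
    define a where "a = nat \<lceil>sqrt \<Lambda>\<rceil>"
    define r where "r = nat \<lceil>log 2 n\<rceil>"
    have \<Lambda>: "1 \<le> \<Lambda>" using elim by (simp add: \<Lambda>_def)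
    have n: "0 < n" using elim by (cases n) auto
    have a: "sqrt \<Lambda> \<le> a" "a \<le> sqrt \<Lambda> + 1" "1 \<le> a"
    proof -
      have "1 \<le> sqrt \<Lambda>" using \<Lambda> by simp
      then show "sqrt \<Lambda> \<le> a" "a \<le> sqrt \<Lambda> + 1" "1 \<le> a" unfolding a_def by linarith+
    qed
    have l2: "0 \<le> log 2 n" using n by simp
    then have r: "log 2 n \<le> r" "r \<le> log 2 n + 1" unfolding r_def by linarith+
    have "real n = 2 powr log 2 n" using n by simp
    also have "\<dots> \<le> 2 powr r" using r by (intro powr_mono) auto
    also have "\<dots> = real (2 ^ r)" by (simp add: powr_realpow)
    finally have "n \<le> 2 ^ r" by (simp only: of_nat_le_iff)
    also have "\<dots> \<le> a * 2 ^ r" using a by simp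
    finally have nr: "n \<le> a * 2 ^ r" .
    have "log 2 n \<le> 3 / 2 * \<Lambda>"
      using ln2_ge_two_thirds \<Lambda> mult_left_mono[of "2 / 3" "ln 2" \<Lambda>] by (simp add: log_def \<Lambda>_def field_simps)
    then have tot: "\<Lambda> + 64 * real r \<le> 161 * \<Lambda>" using r \<Lambda> by linarith
    have dens: "real n * (exp 1 ^ k * (\<Lambda> + 64 * real r)) \<le> m n / 2"
    proof -
      have "real n * (exp 1 ^ k * (\<Lambda> + 64 * real r)) \<le> real n * (exp 1 ^ k * (161 * \<Lambda>))"
        using tot by (intro mult_left_mono) auto
      also have "\<dots> = (322 * exp 1 ^ k * real n * ln (real n)) / 2" by (simp add: \<Lambda>_def)
      also have "\<dots> \<le> m n / 2" using elim by linarith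
      finally show ?thesis .
    qed
    have nm: "n \<le> m n"
    proof -
      have "(1 :: real) \<le> exp 1 ^ k" by (intro one_le_power) simp
      then have "1 \<le> 322 * exp (1 :: real) ^ k" by linarith
      then have "1 * real n * 1 \<le> 322 * exp 1 ^ k * real n * ln (real n)"
        using elim by (intro mult_mono) auto
      then have "real n \<le> real (m n)" using elim by linarith
      then show ?thesis by simp
    qed
    have "(1 + 1 / \<Lambda>) ^ a \<le> exp (1 / \<Lambda>) ^ a"
      using \<Lambda> by (intro power_mono) auto
    also have "\<dots> = exp (a / \<Lambda>)" by (simp flip: exp_of_nat_mult)
    also have "\<dots> \<le> exp ((sqrt \<Lambda> + 1) / \<Lambda>)" using a \<Lambda> by (simp add: divide_right_mono)
    finally have err1: "(1 + 1 / \<Lambda>) ^ a \<le> exp ((sqrt \<Lambda> + 1) / \<Lambda>)" .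
    have "(1 / 4 :: real) ^ a = (1 / 4) powr a" by (simp add: powr_realpow)
    also have "\<dots> \<le> (1 / 4) powr sqrt \<Lambda>" using a by (intro powr_mono') auto
    finally have err2: "real r * (1 / 4) ^ a \<le> (log 2 n + 1) * (1 / 4) powr sqrt \<Lambda>"
      using r l2 by (intro mult_mono) auto
    have err3: "(exp (1 / 2) / 2 :: real) ^ m n \<le> (exp (1 / 2) / 2) ^ n"
      using e2 nm by (intro power_decreasing) auto
    have "1 - ((1 + 1 / \<Lambda>) ^ a - 1 + real r * (1 / 4) ^ a) - (exp (1 / 2) / 2) ^ m n \<le> ?P n"
      using assms elim n nr \<Lambda> dens by (intro prob_HP_lower_bound) auto
    then show ?case using err1 err2 err3 unfolding \<epsilon>_def \<Lambda>_def by linarith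
  qed
  then show "?P \<longlonglongrightarrow> 1"
    by (rule tendsto_sandwich[OF _ _ lim tendsto_const]) auto
qed

end
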